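(* Let $k=k(n)$ be any integer-valued function such that $k(n)\le n/(4\log n)$. Then there is a family of 3-CNF formulas $\{F_{n,k}\}_{n\ge1}$, where $F_{n,k}$ has $O(n^2)$ variables and $O(kn^2)$ clauses, such that: (1) $F_{n,k}$ has a tree-like resolution refutation in size $O(k^k n^k)$, width $2k+1$, and space $2k+3$; (2) any resolution refutation of $F_{n,k}$ has size $\Omega\!\left(\dfrac{n^{k-1}}{(4k\log n)^k}\right)$.
   Context: $\log$ denotes the binary logarithm. A literal is a Boolean variable $x$ or its negation $\bar x$; a clause is a set (disjunction) of literals; a CNF formula is a set (conjunction) of clauses; a 3-CNF formula has clauses with at most 3 literals. A resolution derivation of a clause $C$ from a CNF $F$ is a sequence of clauses $(C_1,\dots,C_\tau)$ with $C_\tau=C$, where each $C_t$ is a clause of $F$, or $A\lor B$ where $C_i=A\lor x$ and $C_j=B\lor\bar x$ for some $i,j<t$ (resolution), or a superset of some $C_i$ with $i<t$ (weakening). A refutation is a derivation of the empty clause. The size is $\tau$; the width is the maximum number of literals in a clause. Associate a DAG with an edge from each premise of an inference or weakening step to its conclusion; the refutation is tree-like if this DAG is a tree. The space at time $t$ is the number of clauses $C_i$, $i\le t$, with an edge to some $C_j$, $j\ge t$, plus $C_t$ itself; the space of the refutation is the maximum over $t$. *)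

theory Defs
  imports Complex_Main "HOL-Library.Landau_Symbols"
begin

datatype 'v literal = Pos (var: 'v) | Neg (var: 'v)

type_synonym 'v clause = "'v literal set"
type_synonym 'v cnf = "'v clause set"

definition vars :: "'v cnf \<Rightarrow> 'v set" where
  "vars F = (\<Union>C\<in>F. var ` C)"

definition is_3cnf :: "'v cnf \<Rightarrow> bool" where
  "is_3cnf F \<longleftrightarrow> finite F \<and> (\<forall>C\<in>F. finite C \<and> card C \<le> 3)"

text \<open>
  A derivation is a sequence of clauses in which every line carries its justification, since
  the associated DAG is determined by the inferences made and not by the clauses alone.
  Lines are numbered from \<open>0\<close>, and premises are referred to by their line numbers.
\<close>

datatype justification = Axiom | Resolution nat nat | Weakening nat

fun premise_lines :: "justification \<Rightarrow> nat set" where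
  "premise_lines Axiom = {}"
| "premise_lines (Resolution i j) = {i, j}"
| "premise_lines (Weakening i) = {i}"

type_synonym 'v derivation = "('v clause \<times> justification) list"

abbreviation clause_at :: "'v derivation \<Rightarrow> nat \<Rightarrow> 'v clause" where
  "clause_at \<pi> t \<equiv> fst (\<pi> ! t)"

definition valid_step :: "'v cnf \<Rightarrow> 'v derivation \<Rightarrow> nat \<Rightarrow> bool" where
  "valid_step F \<pi> t \<longleftrightarrow> (case snd (\<pi> ! t) of
      Axiom \<Rightarrow> clause_at \<pi> t \<in> F
    | Resolution i j \<Rightarrow> i < t \<and> j < t \<and>
        (\<exists>A B x. clause_at \<pi> i = insert (Pos x) A \<and> clause_at \<pi> j = insert (Neg x) B \<and>
          clause_at \<pi> t = A \<union> B)
    | Weakening i \<Rightarrow> i < t \<and> clause_at \<pi> i \<subseteq> clause_at \<pi> t)"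

text \<open>
  Finiteness has to be required of the clauses because weakening could otherwise introduce
  infinite sets of literals, whose \<^const>\<open>card\<close> is \<open>0\<close>.
\<close>

definition derivation :: "'v cnf \<Rightarrow> 'v derivation \<Rightarrow> 'v clause \<Rightarrow> bool" where
  "derivation F \<pi> C \<longleftrightarrow> \<pi> \<noteq> [] \<and> fst (last \<pi>) = C \<and>
     (\<forall>t<length \<pi>. finite (clause_at \<pi> t) \<and> valid_step F \<pi> t)"

definition refutation :: "'v cnf \<Rightarrow> 'v derivation \<Rightarrow> bool" where
  "refutation F \<pi> \<longleftrightarrow> derivation F \<pi> {}"

definition size_of :: "'v derivation \<Rightarrow> nat" where
  "size_of \<pi> = length \<pi>"

definition width_of :: "'v derivation \<Rightarrow> nat" where
  "width_of \<pi> = Max ((\<lambda>t. card (clause_at \<pi> t)) ` {..<length \<pi>})"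

definition dag_edge :: "'v derivation \<Rightarrow> nat \<Rightarrow> nat \<Rightarrow> bool" where
  "dag_edge \<pi> i j \<longleftrightarrow> j < length \<pi> \<and> i \<in> premise_lines (snd (\<pi> ! j))"

text \<open>
  Edges point from earlier to later lines. Hence the DAG is a tree, rooted at the last line
  and with edges directed towards the root, iff every other line has exactly one outgoing edge.
\<close>

definition tree_like :: "'v derivation \<Rightarrow> bool" where
  "tree_like \<pi> \<longleftrightarrow> (\<forall>i. Suc i < length \<pi> \<longrightarrow> (\<exists>!j. dag_edge \<pi> i j))"

text \<open>
  Space counts lines: equal clauses on different lines are counted separately, and the line
  \<open>t\<close> is counted once, whether or not it is used later.
\<close>

definition space_at :: "'v derivation \<Rightarrow> nat \<Rightarrow> nat" where
  "space_at \<pi> t = card ({i. i \<le> t \<and> (\<exists>j\<ge>t. dag_edge \<pi> i j)} \<union> {t})"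

definition space_of :: "'v derivation \<Rightarrow> nat" where
  "space_of \<pi> = Max (space_at \<pi> ` {..<length \<pi>})"

end

theory Submission
  imports Defs "HOL-Library.Countable" "HOL-Library.FuncSet"
begin

text \<open>
  The formula is a relativised pigeonhole principle: each of \<open>k\<close> pigeons chooses an element of
  its own block of \<open>N = n div k + 1\<close> elements, and chosen elements go injectively into \<open>k - 1\<close>
  holes. Disjoint blocks make the choices distinct without any clauses. Brute force over the
  choices of elements and holes gives the tree-like refutation.

  For the lower bound, choose at random one element per block and a bit for each element that is
  not chosen, which satisfies each literal about its hole with probability \<open>1/2\<close>. What
  remains is the pigeonhole principle on the chosen elements, so some clause of the refutation
  survives and mentions at least \<open>k - 1\<close> of them. Let \<open>m = 4 k log n\<close>. A clause mentioning more
  than \<open>m\<close> elements survives with probability at most \<open>2\<^sup>k / n\<^sup>4\<^sup>k\<close>, and one mentioning at most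
  \<open>m\<close> elements contains \<open>k - 1\<close> chosen ones with probability at most \<open>e k (m / n)\<^sup>k\<^sup>-\<^sup>1\<close>, by the
  inequality between the arithmetic and the geometric mean. A union bound finishes the proof.
\<close>

section \<open>Combining tree-like derivations\<close>

fun shift_just :: "nat \<Rightarrow> justification \<Rightarrow> justification" where
  "shift_just d Axiom = Axiom"
| "shift_just d (Resolution i j) = Resolution (d + i) (d + j)"
| "shift_just d (Weakening i) = Weakening (d + i)"

lemma premise_lines_shift_just: "premise_lines (shift_just d J) = (+) d ` premise_lines J"
  by (cases J) auto

definition shift_der :: "nat \<Rightarrow> 'v derivation \<Rightarrow> 'v derivation" where
  "shift_der d \<pi> = map (apsnd (shift_just d)) \<pi>"

lemma length_shift_der [simp]: "length (shift_der d \<pi>) = length \<pi>"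
  by (simp add: shift_der_def)

lemma valid_step_premise_less:
  assumes "valid_step F \<pi> j" "i \<in> premise_lines (snd (\<pi> ! j))"
  shows "i < j"
  using assms by (auto simp: valid_step_def split: justification.splits)

lemma derivation_edge_less:
  assumes "derivation F \<pi> C" "dag_edge \<pi> i j"
  shows "i < j" "j < length \<pi>"
  using assms valid_step_premise_less[of F \<pi> j i] by (auto simp: derivation_def dag_edge_def)

lemma valid_step_append:
  assumes "valid_step F \<pi> t" "t < length \<pi>"
  shows "valid_step F (\<pi> @ \<rho>) t"
  using assms by (auto simp: valid_step_def nth_append split: justification.splits)

lemma valid_step_shift:
  assumes "valid_step F \<pi> t" "t < length \<pi>"
  shows "valid_step F (\<rho> @ shift_der (length \<rho>) \<pi>) (length \<rho> + t)"
  using assms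
  by (auto simp: valid_step_def nth_append shift_der_def split: justification.splits)

lemma dag_edge_append_left:
  assumes "j < length \<pi>"
  shows "dag_edge (\<pi> @ \<rho>) i j \<longleftrightarrow> dag_edge \<pi> i j"
  using assms by (auto simp: dag_edge_def nth_append)

lemma dag_edge_shift:
  "dag_edge (\<rho> @ shift_der (length \<rho>) \<pi> @ \<sigma>) i (length \<rho> + j) \<longleftrightarrow>
     (\<exists>i'. i = length \<rho> + i' \<and> dag_edge \<pi> i' j)" if "j < length \<pi>"
  using that
  by (auto simp: dag_edge_def nth_append shift_der_def premise_lines_shift_just)

lemma dag_edge_snoc_last:
  "dag_edge (\<pi> @ [(C, J)]) i (length \<pi>) \<longleftrightarrow> i \<in> premise_lines J"
  by (auto simp: dag_edge_def)

text \<open>The parameters \<open>s\<close>, \<open>w\<close> and \<open>sp\<close> are upper bounds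
  on size, width and space, so recursive constructions need no exact values. Width and space are
  bounded line by line; maxima are taken only once, for the finished refutation.\<close>

definition tree_derives ::
  "'v cnf \<Rightarrow> nat \<Rightarrow> 'v clause \<Rightarrow> nat \<Rightarrow> nat \<Rightarrow> bool" where
  "tree_derives F w C s sp \<longleftrightarrow> (\<exists>\<pi>. derivation F \<pi> C \<and> tree_like \<pi> \<and> length \<pi> \<le> s \<and>
     (\<forall>t<length \<pi>. card (clause_at \<pi> t) \<le> w \<and> space_at \<pi> t \<le> sp))"

lemma tree_derives_mono:
  assumes "tree_derives F w C s sp" "s \<le> s'" "sp \<le> sp'"
  shows "tree_derives F w C s' sp'"
  using assms unfolding tree_derives_def by (meson le_trans)

lemma tree_derives_axiom:
  assumes "C \<in> F" "finite C" "card C \<le> w"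
  shows "tree_derives F w C 1 1"
  unfolding tree_derives_def
  by (rule exI[of _ "[(C, Axiom)]"])
    (use assms in \<open>auto simp: derivation_def valid_step_def tree_like_def space_at_def dag_edge_def\<close>)

text \<open>Up to the old last line the space is unchanged; at the new line only that line and its
  premise count, hence the 2.\<close>

lemma tree_derives_weaken:
  assumes "tree_derives F w C s sp" "C \<subseteq> D" "finite D" "card D \<le> w"
  shows "tree_derives F w D (s + 1) (max sp 2)"
proof -
  obtain \<pi> where \<pi>: "derivation F \<pi> C" "tree_like \<pi>" "length \<pi> \<le> s"
    and wd: "\<And>t. t < length \<pi> \<Longrightarrow> card (clause_at \<pi> t) \<le> w \<and> space_at \<pi> t \<le> sp"
    using assms(1) unfolding tree_derives_def by blast
  define l where "l = length \<pi>"
  define \<rho> where "\<rho> = \<pi> @ [(D, Weakening (l - 1))]"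
  have l: "l > 0" "clause_at \<pi> (l - 1) = C"
    using \<pi>(1) by (auto simp: derivation_def l_def last_conv_nth)
  have len: "length \<rho> = Suc l" by (simp add: \<rho>_def l_def)
  have edge: "dag_edge \<rho> i j \<longleftrightarrow> dag_edge \<pi> i j \<or> (i = l - 1 \<and> j = l)" for i j
  proof -
    consider "j < l" | "j = l" | "j > l" by linarith
    then show ?thesis
    proof cases
      case 1
      then show ?thesis using dag_edge_append_left[of j \<pi> "[(D, Weakening (l - 1))]" i]
        by (simp add: \<rho>_def l_def)
    next
      case 2
      then show ?thesis using dag_edge_snoc_last[of \<pi> D "Weakening (l - 1)" i]
        derivation_edge_less[OF \<pi>(1), of i j]
        by (auto simp: \<rho>_def l_def)
    next
      case 3
      then show ?thesis by (simp add: dag_edge_def len l_def[symmetric])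
    qed
  qed
  note less = derivation_edge_less[OF \<pi>(1), folded l_def]
  have der: "derivation F \<rho> D"
    unfolding derivation_def len
  proof (intro conjI allI impI)
    fix t assume "t < Suc l"
    then consider "t < l" | "t = l" by linarith
    then have "finite (clause_at \<rho> t) \<and> valid_step F \<rho> t"
    proof cases
      case 1
      then show ?thesis
        using \<pi>(1) by (auto simp: \<rho>_def l_def derivation_def nth_append intro: valid_step_append)
    next
      case 2
      then have "\<rho> ! t = (D, Weakening (l - 1))" "\<rho> ! (l - 1) = \<pi> ! (l - 1)"
        using l by (auto simp: \<rho>_def l_def nth_append)
      then show ?thesis
        using assms l 2 by (simp add: valid_step_def)
    qed
    then show "finite (clause_at \<rho> t)" "valid_step F \<rho> t" by blast+
  qed (auto simp: \<rho>_def)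
  have tree: "tree_like \<rho>"
    unfolding tree_like_def len
  proof (intro allI impI)
    fix i assume i: "Suc i < Suc l"
    show "\<exists>!j. dag_edge \<rho> i j"
    \<comment> \<open>The old last line had no outgoing edge, so the new edge is its only one; every
      other line keeps its own.\<close>
    proof (cases "i = l - 1")
      case True
      then show ?thesis unfolding edge using less[of i] by (intro ex1I[of _ l]) force+
    next
      case False
      then show ?thesis unfolding edge using i \<pi>(2) by (auto simp: tree_like_def l_def)
    qed
  qed
  have sp: "space_at \<rho> t \<le> max sp 2" if t: "t < Suc l" for t
  proof (cases "t = l")
    case True
    have "{i. i \<le> t \<and> (\<exists>j\<ge>t. dag_edge \<rho> i j)} \<union> {t} \<subseteq> {l - 1, l}"
      unfolding edge using True less by fastforce
    then have "space_at \<rho> t \<le> card {l - 1, l}"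
      unfolding space_at_def by (rule card_mono[rotated]) simp
    also have "\<dots> \<le> 2" by (simp add: card_insert_if)
    finally show ?thesis by simp
  next
    case False
    \<comment> \<open>The new edge starts at line \<open>l - 1\<close>, which is at most
      \<open>t\<close> only if \<open>t = l - 1\<close>, and line \<open>t\<close> is counted
      anyway.\<close>
    have "{i. i \<le> t \<and> (\<exists>j\<ge>t. dag_edge \<rho> i j)} \<union> {t}
        = {i. i \<le> t \<and> (\<exists>j\<ge>t. dag_edge \<pi> i j)} \<union> {t}"
      unfolding edge using False t less by auto
    then show ?thesis using wd[of t] False t by (simp add: space_at_def l_def le_max_iff_disj)
  qed
  show ?thesis unfolding tree_derives_def
  proof (intro exI[of _ \<rho>] conjI allI impI)
    fix t assume "t < length \<rho>"
    then show "card (clause_at \<rho> t) \<le> w"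
      using wd[of t] assms(4) by (auto simp: \<rho>_def nth_append less_Suc_eq)
  qed (use der tree sp \<pi>(3) len in \<open>auto simp: l_def\<close>)
qed

definition resolves :: "'v clause \<Rightarrow> 'v clause \<Rightarrow> 'v clause \<Rightarrow> bool" where
  "resolves C C' D \<longleftrightarrow>
     (\<exists>A B x. C = insert (Pos x) A \<and> C' = insert (Neg x) B \<and> D = A \<union> B)"

text \<open>The first derivation is completed and only its last line is kept while the second one
  runs, hence \<open>sp2 + 1\<close>; the 3 is for the final inference. Since this order governs the
  space, it must not depend on which premise has the positive literal.\<close>

lemma tree_derives_resolve:
  assumes "tree_derives F w C1 s1 sp1" "tree_derives F w C2 s2 sp2"
    and res: "resolves C1 C2 D \<or> resolves C2 C1 D" and D: "card D \<le> w"
  shows "tree_derives F w D (s1 + s2 + 1) (max sp1 (max (sp2 + 1) 3))"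
proof -
  obtain \<pi>1 where \<pi>1: "derivation F \<pi>1 C1" "tree_like \<pi>1" "length \<pi>1 \<le> s1"
    and wd1: "\<And>t. t < length \<pi>1 \<Longrightarrow> card (clause_at \<pi>1 t) \<le> w \<and> space_at \<pi>1 t \<le> sp1"
    using assms(1) unfolding tree_derives_def by blast
  obtain \<pi>2 where \<pi>2: "derivation F \<pi>2 C2" "tree_like \<pi>2" "length \<pi>2 \<le> s2"
    and wd2: "\<And>t. t < length \<pi>2 \<Longrightarrow> card (clause_at \<pi>2 t) \<le> w \<and> space_at \<pi>2 t \<le> sp2"
    using assms(2) unfolding tree_derives_def by blast
  define l1 where "l1 = length \<pi>1"
  define l2 where "l2 = length \<pi>2"
  \<comment> \<open>\<open>Resolution\<close> expects the premise with the positive literal first,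
    whichever derivation is carried out first.\<close>
  define J where "J = (if resolves C1 C2 D then Resolution (l1 - 1) (l1 + l2 - 1)
    else Resolution (l1 + l2 - 1) (l1 - 1))"
  define \<sigma> where "\<sigma> = \<pi>1 @ shift_der l1 \<pi>2"
  define \<rho> where "\<rho> = \<sigma> @ [(D, J)]"
  have l: "l1 > 0" "clause_at \<pi>1 (l1 - 1) = C1" "l2 > 0" "clause_at \<pi>2 (l2 - 1) = C2"
    using \<pi>1(1) \<pi>2(1) by (auto simp: derivation_def l1_def l2_def last_conv_nth)
  have lens: "length \<sigma> = l1 + l2" by (simp add: \<sigma>_def l1_def l2_def)
  have len: "length \<rho> = Suc (l1 + l2)" by (simp add: \<rho>_def lens)
  note less1 = derivation_edge_less[OF \<pi>1(1), folded l1_def]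
  note less2 = derivation_edge_less[OF \<pi>2(1), folded l2_def]
  have edge: "dag_edge \<rho> i j \<longleftrightarrow> dag_edge \<pi>1 i j \<or> (l1 \<le> i \<and> l1 \<le> j \<and> dag_edge \<pi>2 (i - l1) (j - l1))
      \<or> (j = l1 + l2 \<and> i \<in> {l1 - 1, l1 + l2 - 1})" (is "_ \<longleftrightarrow> ?R") for i j
  proof -
    consider "j < l1" | "l1 \<le> j" "j < l1 + l2" | "j = l1 + l2" | "j > l1 + l2" by linarith
    then show ?thesis
    proof cases
      case 1
      then show ?thesis by (auto simp: \<rho>_def \<sigma>_def l1_def dag_edge_append_left)
    next
      case 2
      then obtain j' where j': "j = l1 + j'" "j' < l2" by (metis add_less_cancel_left le_iff_add)
      have "dag_edge \<rho> i j \<longleftrightarrow> (\<exists>i'. i = l1 + i' \<and> dag_edge \<pi>2 i' j')"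
        using dag_edge_shift[of j' \<pi>2 \<pi>1 "[(D, J)]" i] j' by (simp add: \<rho>_def \<sigma>_def l1_def l2_def)
      also have "\<dots> \<longleftrightarrow> ?R" using j' less1[of i j] by (auto simp: le_iff_add)
      finally show ?thesis .
    next
      case 3
      then have "dag_edge \<rho> i j \<longleftrightarrow> i \<in> premise_lines J"
        using dag_edge_snoc_last[of \<sigma> D J i] by (simp add: \<rho>_def lens)
      also have "premise_lines J = {l1 - 1, l1 + l2 - 1}" by (auto simp: J_def)
      finally show ?thesis using 3 less1[of i j] less2[of "i - l1" "j - l1"] by auto
    next
      case 4
      then show ?thesis using len less1[of i j] less2[of "i - l1" "j - l1"]
        by (auto simp: dag_edge_def)
    qed
  qed
  have cl1: "clause_at \<rho> t = clause_at \<pi>1 t" if "t < l1" for t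
    using that by (auto simp: \<rho>_def \<sigma>_def l1_def nth_append)
  have cl2: "clause_at \<rho> (l1 + t) = clause_at \<pi>2 t" if "t < l2" for t
    using that by (auto simp: \<rho>_def \<sigma>_def l1_def l2_def nth_append shift_der_def)
  have last: "\<rho> ! (l1 + l2) = (D, J)" by (metis \<rho>_def lens nth_append_length)
  have split: "\<And>t. t < Suc (l1 + l2) \<Longrightarrow> t < l1 \<or> (\<exists>t'<l2. t = l1 + t') \<or> t = l1 + l2"
    by (metis add_less_cancel_left le_iff_add less_SucE not_less)
  have fin: "finite D"
  proof -
    have "finite C1" "finite C2" using \<pi>1(1) \<pi>2(1) l
      by (metis derivation_def diff_less l1_def zero_less_one)
        (metis \<pi>2(1) l(3,4) derivation_def diff_less l2_def zero_less_one)
    then show ?thesis using res by (auto simp: resolves_def)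
  qed
  have last1: "clause_at \<rho> (l1 - 1) = C1" using cl1[of "l1 - 1"] l by simp
  have last2: "clause_at \<rho> (l1 + l2 - 1) = C2" using cl2[of "l2 - 1"] l by simp
  have der: "derivation F \<rho> D"
    unfolding derivation_def len
  proof (intro conjI allI impI)
    fix t assume "t < Suc (l1 + l2)"
    from split[OF this] show "finite (clause_at \<rho> t)"
    proof (elim disjE exE conjE)
      assume "t < l1"
      then show ?thesis using \<pi>1(1) by (simp add: cl1 derivation_def l1_def)
    next
      fix t' assume "t' < l2" "t = l1 + t'"
      then show ?thesis using \<pi>2(1) cl2[of t'] by (simp add: derivation_def l2_def)
    next
      assume "t = l1 + l2"
      then show ?thesis by (simp add: fin last)
    qed
    from split[OF \<open>t < Suc (l1 + l2)\<close>] show "valid_step F \<rho> t"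
    proof (elim disjE exE conjE)
      assume "t < l1"
      then show ?thesis using \<pi>1(1)
        by (auto simp: \<rho>_def \<sigma>_def l1_def derivation_def intro: valid_step_append)
    next
      fix t' assume t': "t' < l2" "t = l1 + t'"
      then have "valid_step F \<sigma> t" using \<pi>2(1) valid_step_shift[of F \<pi>2 t' \<pi>1]
        by (auto simp: \<sigma>_def l1_def l2_def derivation_def)
      then show ?thesis unfolding \<rho>_def by (rule valid_step_append) (use t' lens in simp)
    next
      assume t: "t = l1 + l2"
      show ?thesis
      proof (cases "resolves C1 C2 D")
        case True
        then show ?thesis using l by (auto simp: valid_step_def t last J_def last1[simplified] last2[simplified] resolves_def)
      next
        case False
        then have "resolves C2 C1 D" using res by blast
        then show ?thesis using l False
          by (auto simp: valid_step_def t last J_def last1[simplified] last2[simplified])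
             (auto simp: resolves_def)
      qed
    qed
  qed (auto simp: \<rho>_def)
  have tree: "tree_like \<rho>"
    unfolding tree_like_def len
  proof (intro allI impI)
    fix i assume i: "Suc i < Suc (l1 + l2)"
    \<comment> \<open>The last lines of the two derivations have no edge of their own and get the
      one to the final inference.\<close>
    consider "i < l1 - 1" | "i = l1 - 1" | "l1 \<le> i" "i < l1 + l2 - 1" | "i = l1 + l2 - 1"
      using i by linarith
    then show "\<exists>!j. dag_edge \<rho> i j"
    proof cases
      case 1
      then have "\<exists>!j. dag_edge \<pi>1 i j" using \<pi>1(2) by (auto simp: tree_like_def l1_def)
      then show ?thesis unfolding edge using 1 by auto
    next
      case 2
      then show ?thesis unfolding edge using less1[of i] l
        by (intro ex1I[of _ "l1 + l2"]) force+
    next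
      case 3
      then have "Suc (i - l1) < length \<pi>2" using l by (auto simp: l2_def)
      then have "\<exists>!j. dag_edge \<pi>2 (i - l1) j" using \<pi>2(2) unfolding tree_like_def by blast
      then obtain j where j: "dag_edge \<pi>2 (i - l1) j \<and> (\<forall>j'. dag_edge \<pi>2 (i - l1) j' \<longrightarrow> j' = j)"
        unfolding Ex1_def by (elim exE) (rule that)
      show ?thesis
      proof (rule ex1I[of _ "l1 + j"])
        show "dag_edge \<rho> i (l1 + j)" unfolding edge using 3 conjunct1[OF j] by simp
        fix j' assume "dag_edge \<rho> i j'"
        then have "l1 \<le> j'" "dag_edge \<pi>2 (i - l1) (j' - l1)"
          unfolding edge using 3 less1[of i j'] l by auto
        then show "j' = l1 + j" using conjunct2[OF j] by fastforce
      qed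
    next
      case 4
      then show ?thesis unfolding edge using less1[of i] less2[of "i - l1"] l
        by (intro ex1I[of _ "l1 + l2"]) force+
    qed
  qed
  have sp: "space_at \<rho> t \<le> max sp1 (max (sp2 + 1) 3)" if t: "t < Suc (l1 + l2)" for t
    using split[OF t]
  proof (elim disjE exE conjE)
    assume "t < l1"
    then have "{i. i \<le> t \<and> (\<exists>j\<ge>t. dag_edge \<rho> i j)} \<union> {t}
        \<subseteq> {i. i \<le> t \<and> (\<exists>j\<ge>t. dag_edge \<pi>1 i j)} \<union> {t}"
      unfolding edge by auto
    then have "space_at \<rho> t \<le> space_at \<pi>1 t"
      unfolding space_at_def by (rule card_mono[rotated]) simp
    then show ?thesis using wd1[of t] \<open>t < l1\<close> by (simp add: l1_def le_max_iff_disj)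
  next
    fix t' assume t': "t' < l2" "t = l1 + t'"
    \<comment> \<open>All edges of \<open>\<pi>1\<close> end before \<open>t\<close>, so the only
      line of the first part that is still needed is its last one.\<close>
    have "{i. i \<le> t \<and> (\<exists>j\<ge>t. dag_edge \<rho> i j)} \<union> {t}
        \<subseteq> insert (l1 - 1) ((+) l1 ` ({i. i \<le> t' \<and> (\<exists>j\<ge>t'. dag_edge \<pi>2 i j)} \<union> {t'}))"
      (is "_ \<subseteq> insert _ (_ ` ?S)")
    proof
      fix i assume "i \<in> {i. i \<le> t \<and> (\<exists>j\<ge>t. dag_edge \<rho> i j)} \<union> {t}"
      then consider "i = t" | j where "i \<le> t" "j \<ge> t" "dag_edge \<rho> i j" by blast
      then show "i \<in> insert (l1 - 1) ((+) l1 ` ?S)"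
      proof cases
        case 1
        then show ?thesis using t' by auto
      next
        case 2
        from 2(3)[unfolded edge] show ?thesis
        proof (elim disjE conjE)
          assume "dag_edge \<pi>1 i j"
          then show ?thesis using less1[of i j] 2 t' by auto
        next
          assume *: "l1 \<le> i" "l1 \<le> j" "dag_edge \<pi>2 (i - l1) (j - l1)"
          then have "i - l1 \<le> t'" "j - l1 \<ge> t'" using 2 t' by auto
          then have "i - l1 \<in> ?S" using * by blast
          then show ?thesis using * by (intro insertI2 image_eqI[of _ _ "i - l1"]) auto
        next
          assume "j = l1 + l2" "i \<in> {l1 - 1, l1 + l2 - 1}"
          then show ?thesis using 2 t' by force
        qed
      qed
    qed
    then have "space_at \<rho> t \<le> card (insert (l1 - 1) ((+) l1 ` ?S))"
      unfolding space_at_def by (rule card_mono[rotated]) simp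
    also have "\<dots> \<le> Suc (card ((+) l1 ` ?S))" by (rule card_insert_le_m1) auto
    also have "card ((+) l1 ` ?S) = space_at \<pi>2 t'"
      by (subst card_image) (auto simp: space_at_def)
    finally show ?thesis using wd2[of t'] t' by (auto simp: l2_def le_max_iff_disj)
  next
    assume tt: "t = l1 + l2"
    have "{i. i \<le> t \<and> (\<exists>j\<ge>t. dag_edge \<rho> i j)} \<union> {t} \<subseteq> {l1 - 1, l1 + l2 - 1, l1 + l2}"
      unfolding edge using tt less1 less2 by fastforce
    then have "space_at \<rho> t \<le> card {l1 - 1, l1 + l2 - 1, l1 + l2}"
      unfolding space_at_def by (rule card_mono[rotated]) simp
    also have "\<dots> \<le> 3" by (simp add: card_insert_if)
    finally show ?thesis by simp
  qed
  show ?thesis unfolding tree_derives_def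
  proof (intro exI[of _ \<rho>] conjI allI impI)
    fix t assume "t < length \<rho>"
    then show "card (clause_at \<rho> t) \<le> w" 
      using split[of t] wd1[folded l1_def] wd2[folded l2_def] D by (auto simp: len cl1 cl2 last)
  qed (use der tree sp \<pi>1(3) \<pi>2(3) len in \<open>auto simp: l1_def l2_def\<close>)
qed

section \<open>The formulas\<close>

text \<open>
  \<open>Y u v\<close> reads ``the image of pigeon \<open>u\<close> is at least \<open>v\<close>'', \<open>R u v\<close> ``it is \<open>v\<close>'';
  \<open>Z u v w\<close> and \<open>Q u v w\<close> say the same of the hole of the element \<open>(u, v)\<close>, and
  \<open>E u v u' v'\<close> says that \<open>(u, v)\<close> and \<open>(u', v')\<close> are both chosen.
\<close>

datatype rvar = Y nat nat | R nat nat | Z nat nat nat | Q nat nat nat | E nat nat nat nat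

instance rvar :: countable
  by countable_datatype

text \<open>The wide clauses about having some image and some hole are split into order chains with
  three literals per clause. Only the ends of a hole chain depend on \<open>R u v\<close>: for an
  unchosen element any constant value of its \<open>Z\<close> and \<open>Q\<close> satisfies the
  chain. \<open>E\<close> avoids a collision clause with four literals.\<close>

inductive_set rphp :: "nat \<Rightarrow> nat \<Rightarrow> rvar cnf" for k N :: nat where
  Y_start: "u < k \<Longrightarrow> {Pos (Y u 0)} \<in> rphp k N"
| Y_end: "u < k \<Longrightarrow> {Neg (Y u N)} \<in> rphp k N"
| Y_step: "u < k \<Longrightarrow> v < N \<Longrightarrow> {Neg (Y u v), Pos (Y u (Suc v)), Pos (R u v)} \<in> rphp k N"
| Z_start: "u < k \<Longrightarrow> v < N \<Longrightarrow> {Neg (R u v), Pos (Z u v 0)} \<in> rphp k N"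
| Z_end: "u < k \<Longrightarrow> v < N \<Longrightarrow> {Neg (R u v), Neg (Z u v (k - 1))} \<in> rphp k N"
| Z_step: "u < k \<Longrightarrow> v < N \<Longrightarrow> w < k - 1 \<Longrightarrow>
     {Neg (Z u v w), Pos (Z u v (Suc w)), Pos (Q u v w)} \<in> rphp k N"
| E_intro: "u < u' \<Longrightarrow> u' < k \<Longrightarrow> v < N \<Longrightarrow> v' < N \<Longrightarrow>
     {Neg (R u v), Neg (R u' v'), Pos (E u v u' v')} \<in> rphp k N"
| E_collision: "u < u' \<Longrightarrow> u' < k \<Longrightarrow> v < N \<Longrightarrow> v' < N \<Longrightarrow> w < k - 1 \<Longrightarrow>
     {Neg (E u v u' v'), Neg (Q u v w), Neg (Q u' v' w)} \<in> rphp k N"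

section \<open>Number of clauses and variables\<close>

lemma rphp_subset:
  "rphp k N \<subseteq>
     (\<Union>u\<in>{..<k}. {{Pos (Y u 0)}, {Neg (Y u N)}}) \<union>
     (\<Union>(u, v)\<in>{..<k} \<times> {..<N}. {{Neg (Y u v), Pos (Y u (Suc v)), Pos (R u v)},
        {Neg (R u v), Pos (Z u v 0)}, {Neg (R u v), Neg (Z u v (k - 1))}}) \<union>
     (\<lambda>(u, v, w). {Neg (Z u v w), Pos (Z u v (Suc w)), Pos (Q u v w)}) `
        ({..<k} \<times> {..<N} \<times> {..<k - 1}) \<union>
     (\<lambda>(u, v, u', v'). {Neg (R u v), Neg (R u' v'), Pos (E u v u' v')}) `
        ({..<k} \<times> {..<N} \<times> {..<k} \<times> {..<N}) \<union>
     (\<lambda>(u, v, u', v', w). {Neg (E u v u' v'), Neg (Q u v w), Neg (Q u' v' w)}) `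
        ({..<k} \<times> {..<N} \<times> {..<k} \<times> {..<N} \<times> {..<k - 1})"
  (is "_ \<subseteq> ?A \<union> ?B \<union> ?C \<union> ?D \<union> ?E")
proof
  fix C assume "C \<in> rphp k N"
  then show "C \<in> ?A \<union> ?B \<union> ?C \<union> ?D \<union> ?E"
  proof cases
    case (Z_step u v w)
    then have "C \<in> ?C" by (intro image_eqI[of _ _ "(u, v, w)"]) simp_all
    then show ?thesis by simp
  next
    case (E_intro u u' v v')
    then have "C \<in> ?D" by (intro image_eqI[of _ _ "(u, v, u', v')"]) simp_all
    then show ?thesis by simp
  next
    case (E_collision u u' v v' w)
    then have "C \<in> ?E" by (intro image_eqI[of _ _ "(u, v, u', v', w)"]) simp_all
    then show ?thesis by simp
  qed auto
qed

lemma finite_rphp: "finite (rphp k N)"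
  by (rule finite_subset[OF rphp_subset]) auto

lemma is_3cnf_rphp: "is_3cnf (rphp k N)"
  unfolding is_3cnf_def
proof (intro conjI ballI finite_rphp)
  fix C assume C: "C \<in> rphp k N"
  then show "finite C" by cases simp_all
  from C show "card C \<le> 3" by cases (simp_all add: card_insert_if)
qed

lemma card_UN_le_mult:
  assumes "finite I" "\<And>i. i \<in> I \<Longrightarrow> card (A i) \<le> b"
  shows "card (\<Union>i\<in>I. A i) \<le> card I * b"
  using card_UN_le[OF assms(1), of A] sum_bounded_above[of I "\<lambda>i. card (A i)" b] assms(2)
  by simp

text \<open>There are at most \<open>(k * N)^2 * (k - 1)\<close> collision clauses. Each family is a
  multiple of \<open>k * (k * N)^2\<close> at most, and the coefficients 2, 3, 1, 1, 1 add up to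
  8.\<close>

lemma card_rphp_le:
  assumes "1 \<le> k" "k \<le> k * N"
  shows "card (rphp k N) \<le> 8 * k * (k * N)\<^sup>2"
proof -
  have "card (rphp k N) \<le> card {..<k} * 2 + card ({..<k} \<times> {..<N}) * 3
      + card ({..<k} \<times> {..<N} \<times> {..<k - 1})
      + card ({..<k} \<times> {..<N} \<times> {..<k} \<times> {..<N})
      + card ({..<k} \<times> {..<N} \<times> {..<k} \<times> {..<N} \<times> {..<k - 1})"
    by (rule card_mono[OF _ rphp_subset, THEN order_trans], force,
        intro card_Un_le[THEN order_trans] add_mono card_UN_le_mult card_image_le)
       (auto simp: card_insert_if)
  also have "\<dots> = 2 * k + 3 * (k * N) + (k * N) * (k - 1) + (k * N)\<^sup>2 + (k * N)\<^sup>2 * (k - 1)"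
    by (simp add: power2_eq_square algebra_simps)
  also have "\<dots> \<le> 2 * (k * (k * N)\<^sup>2) + 3 * (k * (k * N)\<^sup>2) + k * (k * N)\<^sup>2 + k * (k * N)\<^sup>2 + k * (k * N)\<^sup>2"
  proof -
    define M where "M = k * N"
    have M: "1 \<le> M" "M \<le> M\<^sup>2" "1 \<le> M\<^sup>2" using assms by (auto simp: M_def power2_eq_square)
    have "k * 1 \<le> k * M\<^sup>2" "1 * M\<^sup>2 \<le> k * M\<^sup>2" "M * (k - 1) \<le> M\<^sup>2 * k" "M\<^sup>2 * (k - 1) \<le> M\<^sup>2 * k"
      using mult_le_mono[OF order_refl M(3), of k] mult_le_mono[OF assms(1), of "M\<^sup>2" "M\<^sup>2"]
        mult_le_mono[OF M(2), of "k - 1" k] mult_le_mono[of "M\<^sup>2" "M\<^sup>2" "k - 1" k]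
      by simp_all
    then show ?thesis using M by (simp only: M_def[symmetric] mult.commute[of _ k])
  qed
  finally show ?thesis by simp
qed

lemma card_vars_rphp_le:
  assumes "k \<le> k * N"
  shows "card (vars (rphp k N)) \<le> 8 * (k * N)\<^sup>2"
proof -
  \<comment> \<open>The chains end in \<open>Y u N\<close> and \<open>Z u v (k - 1)\<close>, one
    past the last element and the last hole.\<close>
  define V where "V = case_prod Y ` ({..<k} \<times> {..N}) \<union> case_prod R ` ({..<k} \<times> {..<N})
    \<union> (\<lambda>(u, v, w). Z u v w) ` ({..<k} \<times> {..<N} \<times> {..<k})
    \<union> (\<lambda>(u, v, w). Q u v w) ` ({..<k} \<times> {..<N} \<times> {..<k})
    \<union> (\<lambda>(u, v, u', v'). E u v u' v') ` ({..<k} \<times> {..<N} \<times> {..<k} \<times> {..<N})"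
  have "var ` C \<subseteq> V" if "C \<in> rphp k N" for C
    using that
    by cases (force simp: V_def image_iff)+
  then have "vars (rphp k N) \<subseteq> V" by (auto simp: vars_def)
  then have "card (vars (rphp k N)) \<le> card V"
    by (rule card_mono[rotated]) (simp add: V_def)
  also have "\<dots> \<le> card ({..<k} \<times> {..N}) + card ({..<k} \<times> {..<N})
     + card ({..<k} \<times> {..<N} \<times> {..<k}) + card ({..<k} \<times> {..<N} \<times> {..<k})
     + card ({..<k} \<times> {..<N} \<times> {..<k} \<times> {..<N})"
    unfolding V_def
    by (intro card_Un_le[THEN order_trans] add_mono card_image_le) auto
  also have "\<dots> = k + 2 * (k * N) + 2 * (k * N * k) + (k * N)\<^sup>2"
    by (simp add: power2_eq_square algebra_simps)
  also have "\<dots> \<le> 8 * (k * N)\<^sup>2"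
  proof -
    have "k * N * k \<le> (k * N)\<^sup>2" using assms by (simp add: power2_eq_square)
    moreover have "k * N \<le> (k * N)\<^sup>2" by (simp add: power2_eq_square)
    ultimately show ?thesis using assms by linarith
  qed
  finally show ?thesis .
qed

section \<open>The tree-like refutation\<close>

text \<open>The list is a node of the search tree: the images and holes guessed for pigeons 0, 1,
  and so on. The clause says that the guess is wrong; it spends two literals per pigeon.\<close>

definition choice_clause :: "(nat \<times> nat) list \<Rightarrow> rvar clause" where
  "choice_clause xs =
     (\<Union>i<length xs. {Neg (R i (fst (xs ! i))), Neg (Q i (fst (xs ! i)) (snd (xs ! i)))})"

lemma choice_clause_Nil [simp]: "choice_clause [] = {}"
  by (simp add: choice_clause_def)

lemma choice_clause_snoc:
  "choice_clause (xs @ [(v, w)]) =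
     {Neg (R (length xs) v), Neg (Q (length xs) v w)} \<union> choice_clause xs"
  by (auto simp: choice_clause_def nth_append lessThan_Suc split: if_splits)

lemma finite_choice_clause [simp]: "finite (choice_clause xs)"
  by (simp add: choice_clause_def)

lemma card_choice_clause: "card (choice_clause xs) \<le> 2 * length xs"
proof -
  have "card (choice_clause xs) \<le> card {..<length xs} * 2"
    unfolding choice_clause_def by (rule card_UN_le_mult) (auto simp: card_insert_if)
  then show ?thesis by simp
qed

lemma card_insert_le_Suc: "finite A \<Longrightarrow> card A \<le> n \<Longrightarrow> card (insert x A) \<le> Suc n"
  by (simp add: card_insert_if)

lemma resolvesI:
  "C = insert (Pos x) A \<Longrightarrow> C' = insert (Neg x) B \<Longrightarrow> D = A \<union> B \<Longrightarrow> resolves C C' D"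
  unfolding resolves_def by blast

section \<open>Brute-force search, one level per pigeon\<close>

context
  fixes k N :: nat
  assumes k: "1 \<le> k" and N: "1 \<le> N"
begin

abbreviation derives :: "rvar clause \<Rightarrow> nat \<Rightarrow> nat \<Rightarrow> bool" where
  "derives \<equiv> tree_derives (rphp k N) (2 * k + 1)"

lemma derives_axiom:
  assumes "C \<in> rphp k N"
  shows "derives C 1 1"
proof (rule tree_derives_axiom[OF assms])
  show "finite C" using is_3cnf_rphp assms by (auto simp: is_3cnf_def)
  have "card C \<le> 3" using is_3cnf_rphp assms by (auto simp: is_3cnf_def)
  then show "card C \<le> 2 * k + 1" using k by simp
qed

text \<open>At a leaf, \<open>k\<close> pigeons share \<open>k - 1\<close> holes, so two collide.
  The clauses for this pair resolve on \<open>E\<close> to a subclause. The 4 lines are two axioms,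
  a resolvent and a weakening.\<close>

lemma derives_full_choice:
  assumes len: "length xs = k" and xs: "set xs \<subseteq> {..<N} \<times> {..<k - 1}"
  shows "derives (choice_clause xs) 4 3"
proof -
  have "\<not> inj_on (\<lambda>i. snd (xs ! i)) {..<k}"
  proof
    assume "inj_on (\<lambda>i. snd (xs ! i)) {..<k}"
    moreover have "(\<lambda>i. snd (xs ! i)) ` {..<k} \<subseteq> {..<k - 1}"
      using xs len nth_mem[of _ xs] by fastforce
    ultimately have "card {..<k} \<le> card {..<k - 1}" by (meson card_inj_on_le finite_lessThan)
    then show False using k by simp
  qed
  then obtain i j where ij: "i < j" "j < k" "snd (xs ! i) = snd (xs ! j)"
    unfolding inj_on_def by (metis lessThan_iff linorder_neqE_nat)
  obtain v w v' where v: "xs ! i = (v, w)" "xs ! j = (v', w)"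
    using ij by (metis prod.collapse)
  have mem: "(v, w) \<in> set xs" "(v', w) \<in> set xs" using ij v len by (metis less_trans nth_mem)+
  then have bnd: "v < N" "v' < N" "w < k - 1" using xs by auto
  let ?D = "{Neg (R i v), Neg (R j v'), Neg (Q i v w), Neg (Q j v' w)} :: rvar clause"
  have D: "derives ?D (1 + 1 + 1) (max 1 (max (1 + 1) 3))"
  proof (rule tree_derives_resolve[OF derives_axiom[OF rphp.E_intro] derives_axiom[OF rphp.E_collision]])
    show "resolves {Neg (R i v), Neg (R j v'), Pos (E i v j v')}
      {Neg (E i v j v'), Neg (Q i v w), Neg (Q j v' w)} ?D \<or>
     resolves {Neg (E i v j v'), Neg (Q i v w), Neg (Q j v' w)}
      {Neg (R i v), Neg (R j v'), Pos (E i v j v')} ?D"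
      by (rule disjI1, rule resolvesI[of _ "E i v j v'" "{Neg (R i v), Neg (R j v')}" _ "{Neg (Q i v w), Neg (Q j v' w)}"]) auto
    \<comment> \<open>A collision needs two pigeons, so \<open>k\<close> is at least 2 and four
      literals fit into the width.\<close>
    have "card ?D \<le> 4" by (simp add: card_insert_if)
    then show "card ?D \<le> 2 * k + 1" using ij by linarith
  qed (use ij bnd in auto)
  have "derives (choice_clause xs) (1 + 1 + 1 + 1) (max (max 1 (max (1 + 1) 3)) 2)"
  proof (rule tree_derives_weaken[OF D])
    have "{Neg (R i v), Neg (Q i v w)} \<subseteq> choice_clause xs"
      "{Neg (R j v'), Neg (Q j v' w)} \<subseteq> choice_clause xs"
      unfolding choice_clause_def using ij v len by force+
    then show "?D \<subseteq> choice_clause xs" by blast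
    show "card (choice_clause xs) \<le> 2 * k + 1" using card_choice_clause[of xs] len by simp
  qed simp
  then show ?thesis by (rule tree_derives_mono) simp_all
qed

text \<open>The hole chain is descended from its end, with the \<open>d\<close> largest holes
  already excluded. A step costs one subderivation, an axiom and two resolvents, hence
  \<open>s + 3\<close>. The chain clause is derived before the subderivation and is all that is
  stored meanwhile, so the space does not grow with \<open>d\<close>.\<close>

lemma derives_hole_chain:
  assumes u: "u < k" and v: "v < N" and fin: "finite K" and card: "card K \<le> 2 * u"
    and sub: "\<And>w. w < k - 1 \<Longrightarrow> derives ({Neg (R u v), Neg (Q u v w)} \<union> K) s sp"
    and sp: "3 \<le> sp" and d: "d \<le> k - 1"
  shows "derives ({Neg (R u v), Neg (Z u v (k - 1 - d))} \<union> K) (2 + d * (s + 3)) (sp + 1)"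
  using d
proof (induction d)
  case 0
  have "derives ({Neg (R u v), Neg (Z u v (k - 1))} \<union> K) (1 + 1) (max 1 2)"
  proof (rule tree_derives_weaken[OF derives_axiom[OF rphp.Z_end[OF u v]]])
    have "card (insert (Neg (R u v)) (insert (Neg (Z u v (k - 1))) K)) \<le> Suc (Suc (2 * u))"
      using fin card by (intro card_insert_le_Suc) auto
    then show "card ({Neg (R u v), Neg (Z u v (k - 1))} \<union> K) \<le> 2 * k + 1" using u by simp
  qed (use fin in auto)
  then have "derives ({Neg (R u v), Neg (Z u v (k - 1))} \<union> K) 2 (sp + 1)"
    by (rule tree_derives_mono) (use sp in auto)
  then show ?case by simp
next
  case (Suc d)
  define w where "w = k - 1 - Suc d"
  have w: "w < k - 1" "Suc w = k - 1 - d" using Suc.prems by (auto simp: w_def)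
  let ?C = "{Neg (R u v), Neg (Z u v w), Pos (Q u v w)} \<union> K"
  have 1: "derives ?C (2 + d * (s + 3) + 1 + 1) (max (sp + 1) (max (1 + 1) 3))"
  proof (rule tree_derives_resolve[OF _ derives_axiom[OF rphp.Z_step[OF u v w(1)]]])
    show "derives ({Neg (R u v), Neg (Z u v (Suc w))} \<union> K) (2 + d * (s + 3)) (sp + 1)"
      using Suc w by simp
    show "resolves ({Neg (R u v), Neg (Z u v (Suc w))} \<union> K)
       {Neg (Z u v w), Pos (Z u v (Suc w)), Pos (Q u v w)} ?C \<or>
     resolves {Neg (Z u v w), Pos (Z u v (Suc w)), Pos (Q u v w)}
       ({Neg (R u v), Neg (Z u v (Suc w))} \<union> K) ?C"
      by (rule disjI2, rule resolvesI[of _ "Z u v (Suc w)" "{Neg (Z u v w), Pos (Q u v w)}" _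
        "insert (Neg (R u v)) K"]) auto
    \<comment> \<open>Three literals on top of \<open>2 * u\<close> use up the whole width
      \<open>2 * k + 1\<close> when \<open>u = k - 1\<close>.\<close>
    have "card (insert (Neg (R u v)) (insert (Neg (Z u v w)) (insert (Pos (Q u v w)) K)))
        \<le> Suc (Suc (Suc (2 * u)))"
      using fin card by (intro card_insert_le_Suc) auto
    then show "card ?C \<le> 2 * k + 1" using u by simp
  qed
  let ?D = "{Neg (R u v), Neg (Z u v w)} \<union> K"
  have 2: "derives ?D (2 + d * (s + 3) + 1 + 1 + s + 1)
      (max (max (sp + 1) (max (1 + 1) 3)) (max (sp + 1) 3))"
  proof (rule tree_derives_resolve[OF 1 sub[OF w(1)]])
    show "resolves ?C ({Neg (R u v), Neg (Q u v w)} \<union> K) ?D \<or>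
      resolves ({Neg (R u v), Neg (Q u v w)} \<union> K) ?C ?D"
      by (rule disjI1, rule resolvesI[of _ "Q u v w" ?D _ "insert (Neg (R u v)) K"]) auto
    have "card (insert (Neg (R u v)) (insert (Neg (Z u v w)) K)) \<le> Suc (Suc (2 * u))"
      using fin card by (intro card_insert_le_Suc) auto
    then show "card ?D \<le> 2 * k + 1" using u by simp
  qed
  then show ?case unfolding w_def[symmetric] by (rule tree_derives_mono) (use sp in auto)
qed

lemma derives_holes:
  assumes u: "u < k" and v: "v < N" and fin: "finite K" and card: "card K \<le> 2 * u"
    and sub: "\<And>w. w < k - 1 \<Longrightarrow> derives ({Neg (R u v), Neg (Q u v w)} \<union> K) s sp"
    and sp: "3 \<le> sp" and s: "1 \<le> s"
  shows "derives (insert (Neg (R u v)) K) (4 * k * s) (sp + 1)"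
proof -
  have 0: "derives ({Neg (R u v), Neg (Z u v 0)} \<union> K) (2 + (k - 1) * (s + 3)) (sp + 1)"
    using derives_hole_chain[OF assms(1-6), of "k - 1"] by simp
  have "derives (insert (Neg (R u v)) K) (2 + (k - 1) * (s + 3) + 1 + 1)
      (max (sp + 1) (max (1 + 1) 3))"
  proof (rule tree_derives_resolve[OF 0 derives_axiom[OF rphp.Z_start[OF u v]]])
    show "resolves ({Neg (R u v), Neg (Z u v 0)} \<union> K) {Neg (R u v), Pos (Z u v 0)} (insert (Neg (R u v)) K) \<or>
     resolves {Neg (R u v), Pos (Z u v 0)} ({Neg (R u v), Neg (Z u v 0)} \<union> K) (insert (Neg (R u v)) K)"
      by (rule disjI2, rule resolvesI[of _ "Z u v 0" "{Neg (R u v)}" _ "insert (Neg (R u v)) K"]) auto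
    have "card (insert (Neg (R u v)) K) \<le> Suc (2 * u)"
      using fin card by (intro card_insert_le_Suc) auto
    then show "card (insert (Neg (R u v)) K) \<le> 2 * k + 1" using u by simp
  qed
  then show ?thesis
  proof (rule tree_derives_mono)
    have "(k - 1) * (s + 3) \<le> (k - 1) * (4 * s)" using s by (intro mult_le_mono2) simp
    then have "2 + (k - 1) * (s + 3) + 1 + 1 \<le> (k - 1) * (4 * s) + 4 * s" using s by linarith
    also have "\<dots> = 4 * k * s" using k by (cases k) (auto simp: algebra_simps)
    finally show "2 + (k - 1) * (s + 3) + 1 + 1 \<le> 4 * k * s" .
  qed (use sp in simp)
qed

text \<open>The same descent, along the \<open>Y\<close> chain of pigeon \<open>u\<close>; the
  subderivations now exclude its possible images.\<close>

lemma derives_image_chain: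
  assumes u: "u < k" and fin: "finite K" and card: "card K \<le> 2 * u"
    and sub: "\<And>v. v < N \<Longrightarrow> derives (insert (Neg (R u v)) K) s sp"
    and sp: "3 \<le> sp" and d: "d \<le> N"
  shows "derives (insert (Neg (Y u (N - d))) K) (2 + d * (s + 3)) (sp + 1)"
  using d
proof (induction d)
  case 0
  have "derives (insert (Neg (Y u N)) K) (1 + 1) (max 1 2)"
  proof (rule tree_derives_weaken[OF derives_axiom[OF rphp.Y_end[OF u]]])
    have "card (insert (Neg (Y u N)) K) \<le> Suc (2 * u)"
      using fin card by (intro card_insert_le_Suc) auto
    then show "card (insert (Neg (Y u N)) K) \<le> 2 * k + 1" using u by simp
  qed (use fin in auto)
  then have "derives (insert (Neg (Y u N)) K) 2 (sp + 1)"
    by (rule tree_derives_mono) (use sp in auto)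
  then show ?case by simp
next
  case (Suc d)
  define v where "v = N - Suc d"
  have v: "v < N" "Suc v = N - d" using Suc.prems by (auto simp: v_def)
  let ?C = "{Neg (Y u v), Pos (R u v)} \<union> K"
  have 1: "derives ?C (2 + d * (s + 3) + 1 + 1) (max (sp + 1) (max (1 + 1) 3))"
  proof (rule tree_derives_resolve[OF _ derives_axiom[OF rphp.Y_step[OF u v(1)]]])
    show "derives (insert (Neg (Y u (Suc v))) K) (2 + d * (s + 3)) (sp + 1)"
      using Suc v by simp
    show "resolves (insert (Neg (Y u (Suc v))) K)
       {Neg (Y u v), Pos (Y u (Suc v)), Pos (R u v)} ?C \<or>
     resolves {Neg (Y u v), Pos (Y u (Suc v)), Pos (R u v)}
       (insert (Neg (Y u (Suc v))) K) ?C"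
      by (rule disjI2, rule resolvesI[of _ "Y u (Suc v)" "{Neg (Y u v), Pos (R u v)}" _ K]) auto
    have "card (insert (Neg (Y u v)) (insert (Pos (R u v)) K)) \<le> Suc (Suc (2 * u))"
      using fin card by (intro card_insert_le_Suc) auto
    then show "card ?C \<le> 2 * k + 1" using u by simp
  qed
  let ?D = "insert (Neg (Y u v)) K"
  have 2: "derives ?D (2 + d * (s + 3) + 1 + 1 + s + 1)
      (max (max (sp + 1) (max (1 + 1) 3)) (max (sp + 1) 3))"
  proof (rule tree_derives_resolve[OF 1 sub[OF v(1)]])
    show "resolves ?C (insert (Neg (R u v)) K) ?D \<or> resolves (insert (Neg (R u v)) K) ?C ?D"
      by (rule disjI1, rule resolvesI[of _ "R u v" ?D _ K]) auto
    have "card (insert (Neg (Y u v)) K) \<le> Suc (2 * u)"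
      using fin card by (intro card_insert_le_Suc) auto
    then show "card ?D \<le> 2 * k + 1" using u by simp
  qed
  then show ?case unfolding v_def[symmetric] by (rule tree_derives_mono) (use sp in auto)
qed

lemma derives_images:
  assumes u: "u < k" and fin: "finite K" and card: "card K \<le> 2 * u"
    and sub: "\<And>v. v < N \<Longrightarrow> derives (insert (Neg (R u v)) K) s sp"
    and sp: "3 \<le> sp" and s: "1 \<le> s"
  shows "derives K (8 * N * s) (sp + 1)"
proof -
  have 0: "derives (insert (Neg (Y u 0)) K) (2 + N * (s + 3)) (sp + 1)"
    using derives_image_chain[OF assms(1-5), of N] by simp
  have "derives K (2 + N * (s + 3) + 1 + 1) (max (sp + 1) (max (1 + 1) 3))"
  proof (rule tree_derives_resolve[OF 0 derives_axiom[OF rphp.Y_start[OF u]]])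
    show "resolves (insert (Neg (Y u 0)) K) {Pos (Y u 0)} K \<or>
       resolves {Pos (Y u 0)} (insert (Neg (Y u 0)) K) K"
      by (rule disjI2, rule resolvesI[of _ "Y u 0" "{}" _ K]) auto
    show "card K \<le> 2 * k + 1" using u card by simp
  qed
  then show ?thesis
  proof (rule tree_derives_mono)
    have "N * (s + 3) \<le> N * (4 * s)" using s by (intro mult_le_mono2) simp
    moreover have "1 \<le> N * s" using s N by simp
    moreover have "N * (4 * s) = 4 * (N * s)" "8 * N * s = 8 * (N * s)" by simp_all
    ultimately show "2 + N * (s + 3) + 1 + 1 \<le> 8 * N * s" by linarith
  qed (use sp in simp)
qed

text \<open>Here \<open>d\<close> pigeons are still undecided. A level multiplies the size by
  \<open>8 * N\<close> for the image and by \<open>4 * k\<close> for the hole, and each of the two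
  chains adds 1 to the space.\<close>

lemma derives_choice_clause:
  assumes "d \<le> k" "length xs = k - d" "set xs \<subseteq> {..<N} \<times> {..<k - 1}"
  shows "derives (choice_clause xs) (4 * (32 * k * N) ^ d) (2 * d + 3)"
  using assms
proof (induction d arbitrary: xs)
  case 0
  then show ?case using derives_full_choice[of xs] by simp
next
  case (Suc d)
  let ?u = "length xs"
  have u: "?u < k" "Suc ?u = k - d" using Suc.prems by auto
  have pos: "1 \<le> 4 * (32 * k * N) ^ d" using k N by simp
  have "derives (choice_clause xs) (8 * N * (4 * k * (4 * (32 * k * N) ^ d))) (2 * d + 3 + 1 + 1)"
  proof (rule derives_images[OF u(1) finite_choice_clause card_choice_clause])
    fix v assume v: "v < N"
    show "derives (insert (Neg (R ?u v)) (choice_clause xs)) (4 * k * (4 * (32 * k * N) ^ d)) (2 * d + 3 + 1)"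
    proof (rule derives_holes[OF u(1) v finite_choice_clause card_choice_clause _ _ pos])
      fix w assume "w < k - 1"
      then show "derives ({Neg (R ?u v), Neg (Q ?u v w)} \<union> choice_clause xs)
          (4 * (32 * k * N) ^ d) (2 * d + 3)"
        unfolding choice_clause_snoc[symmetric]
        by (intro Suc.IH) (use Suc.prems u v in auto)
    qed simp
  qed (use k N in auto)
  then show ?case by (rule tree_derives_mono) (auto simp: algebra_simps)
qed

lemma rphp_tree_refutation: "derives {} (4 * (32 * k * N) ^ k) (2 * k + 3)"
  using derives_choice_clause[of k "[]"] by simp

end

section \<open>The size lower bound\<close>

fun holds :: "('v \<Rightarrow> bool) \<Rightarrow> 'v literal \<Rightarrow> bool" where
  "holds a (Pos x) \<longleftrightarrow> a x"
| "holds a (Neg x) \<longleftrightarrow> \<not> a x"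

definition falsifies :: "('v \<Rightarrow> bool) \<Rightarrow> 'v clause \<Rightarrow> bool" where
  "falsifies a C \<longleftrightarrow> (\<forall>l\<in>C. \<not> holds a l)"

text \<open>Only \<open>Z\<close> and \<open>Q\<close> have an element: the values of
  \<open>Y\<close>, \<open>R\<close> and \<open>E\<close> will depend on the chosen elements alone,
  not on bits or holes.\<close>

fun element :: "rvar \<Rightarrow> (nat \<times> nat) set" where
  "element (Z u v w) = {(u, v)}"
| "element (Q u v w) = {(u, v)}"
| "element _ = {}"

definition mentioned :: "rvar clause \<Rightarrow> (nat \<times> nat) set" where
  "mentioned C = (\<Union>l\<in>C. element (var l))"

text \<open>
  Pigeon \<open>u\<close> goes to the element \<open>(u, s u)\<close>, which goes to the hole \<open>h u\<close>; all \<open>Z\<close> and \<open>Q\<close>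
  variables of any other element \<open>e\<close> get the single random bit \<open>e \<in> b\<close>.
\<close>

fun assignment ::
  "nat \<Rightarrow> (nat \<Rightarrow> nat) \<Rightarrow> (nat \<times> nat) set \<Rightarrow> (nat \<Rightarrow> nat) \<Rightarrow> rvar \<Rightarrow> bool" where
  "assignment k s b h (Y u v) \<longleftrightarrow> v \<le> s u"
| "assignment k s b h (R u v) \<longleftrightarrow> v = s u"
| "assignment k s b h (E u v u' v') \<longleftrightarrow> v = s u \<and> v' = s u'"
| "assignment k s b h (Z u v w) \<longleftrightarrow> (if u < k \<and> v = s u then w \<le> h u else (u, v) \<in> b)"
| "assignment k s b h (Q u v w) \<longleftrightarrow> (if u < k \<and> v = s u then w = h u else (u, v) \<in> b)"

text \<open>These are the only pigeons whose holes can affect the truth of the clause. Their number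
  plays the part of the width in the pigeonhole principle that remains.\<close>

definition matched :: "nat \<Rightarrow> (nat \<Rightarrow> nat) \<Rightarrow> rvar clause \<Rightarrow> nat set" where
  "matched k s C = {u. u < k \<and> (u, s u) \<in> mentioned C}"

lemma matched_subset: "matched k s C \<subseteq> {..<k}"
  by (auto simp: matched_def)

lemma finite_matched [simp]: "finite (matched k s C)"
  by (rule finite_subset[OF matched_subset]) simp

lemma matched_mono: "C \<subseteq> D \<Longrightarrow> matched k s C \<subseteq> matched k s D"
  by (auto simp: matched_def mentioned_def)

lemma falsifies_cong:
  assumes "\<And>u. u \<in> matched k s C \<Longrightarrow> h u = h' u"
  shows "falsifies (assignment k s b h) C \<longleftrightarrow> falsifies (assignment k s b h') C"
proof -
  have "assignment k s b h (var l) = assignment k s b h' (var l)" if "l \<in> C" for l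
  proof (cases "var l")
    case (Z u v w)
    then have "(u, v) \<in> mentioned C" using that by (force simp: mentioned_def)
    then show ?thesis using assms[of u] Z by (auto simp: matched_def)
  next
    case (Q u v w)
    then have "(u, v) \<in> mentioned C" using that by (force simp: mentioned_def)
    then show ?thesis using assms[of u] Q by (auto simp: matched_def)
  qed auto
  then have "holds (assignment k s b h) l = holds (assignment k s b h') l" if "l \<in> C" for l
    using that by (cases l) force+
  then show ?thesis by (simp add: falsifies_def)
qed

lemma extend_injection:
  fixes h :: "'a \<Rightarrow> nat"
  assumes "finite D" "card D < n" "inj_on h D" "h ` D \<subseteq> {..<n}"
  obtains h' where "\<And>u. u \<in> D \<Longrightarrow> h' u = h u" "inj_on h' (insert x D)" "h' ` insert x D \<subseteq> {..<n}"
proof (cases "x \<in> D")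
  case True
  then show ?thesis using that[of h] assms by (simp add: insert_absorb)
next
  case False
  have "card (h ` D) < card {..<n}" using assms card_image_le[of D h] by simp
  then obtain w where w: "w < n" "w \<notin> h ` D"
    using assms by (metis finite_imageI card_mono lessThan_iff not_less subsetI)
  let ?h = "h(x := w)"
  have img: "?h ` D = h ` D" using False by (intro image_cong) auto
  show ?thesis
  proof (rule that[of ?h])
    show "inj_on ?h (insert x D)"
      using assms False w img by (simp add: inj_on_fun_updI)
    show "?h ` insert x D \<subseteq> {..<n}" using assms w img by auto
  qed (use False in auto)
qed

text \<open>Otherwise every falsified line matches fewer than \<open>k - 1\<close> pigeons, which
  leaves a free hole for one more. By induction, no line is then falsified by a hole map injective
  on its matched pigeons; but the empty last line always is.\<close>

lemma exists_matched_clause: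
  assumes ref: "refutation (rphp k N) \<pi>" and s: "\<And>u. u < k \<Longrightarrow> s u < N"
  shows "\<exists>t<length \<pi>. (\<exists>h. falsifies (assignment k s b h) (clause_at \<pi> t)) \<and>
           k - 1 \<le> card (matched k s (clause_at \<pi> t))"
proof (rule ccontr)
  assume "\<not> ?thesis"
  then have small: "card (matched k s (clause_at \<pi> t)) < k - 1"
    if "t < length \<pi>" "falsifies (assignment k s b h) (clause_at \<pi> t)" for t h
    using that by (meson not_le)
  have no: "\<not> falsifies (assignment k s b h) (clause_at \<pi> t)"
    if "t < length \<pi>" "inj_on h (matched k s (clause_at \<pi> t))"
      "h ` matched k s (clause_at \<pi> t) \<subseteq> {..<k - 1}" for t h
    using that
  proof (induction t arbitrary: h rule: less_induct)
    case (less t)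
    let ?C = "clause_at \<pi> t" and ?D = "matched k s (clause_at \<pi> t)"
    have step: "valid_step (rphp k N) \<pi> t"
      using ref less.prems by (auto simp: refutation_def derivation_def)
    show ?case
    proof
      assume fals: "falsifies (assignment k s b h) ?C"
      then have neg: "\<not> holds (assignment k s b h) l" if "l \<in> ?C" for l
        using that by (simp add: falsifies_def)
      show False
      proof (cases "snd (\<pi> ! t)")
        case Axiom
        have hole: "h u < k - 1" if "(u, s u) \<in> mentioned ?C" "u < k" for u
          using less.prems(3) that by (auto simp: matched_def)
        from Axiom step have "?C \<in> rphp k N" by (simp add: valid_step_def)
        then show False
        proof cases
          case (Y_start u)
          then show False using neg[of "Pos (Y u 0)"] by simp
        next
          case (Y_end u)
          then show False using neg[of "Neg (Y u N)"] s[of u] by simp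
        next
          case (Y_step u v)
          then have "v \<le> s u" "\<not> Suc v \<le> s u" "v \<noteq> s u"
            using neg[of "Neg (Y u v)"] neg[of "Pos (Y u (Suc v))"] neg[of "Pos (R u v)"] by simp_all
          then show False by linarith
        next
          case (Z_start u v)
          then have "v = s u" using neg[of "Neg (R u v)"] by simp
          then show False using neg[of "Pos (Z u v 0)"] Z_start by simp
        next
          case (Z_end u v)
          then have v: "v = s u" using neg[of "Neg (R u v)"] by simp
          then have "(u, s u) \<in> mentioned ?C" using Z_end by (simp add: mentioned_def)
          then show False using neg[of "Neg (Z u v (k - 1))"] hole[of u] Z_end v by simp
        next
          \<comment> \<open>For a chosen element, \<open>w \<le> h u\<close> without
            \<open>Suc w \<le> h u\<close> forces \<open>w = h u\<close>; for any other, the common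
            bit makes one of the two \<open>Z\<close> literals true.\<close>
          case (Z_step u v w)
          then show False
            using neg[of "Neg (Z u v w)"] neg[of "Pos (Z u v (Suc w))"] neg[of "Pos (Q u v w)"]
            by (simp split: if_splits)
        next
          case (E_intro u u' v v')
          then show False
            using neg[of "Neg (R u v)"] neg[of "Neg (R u' v')"] neg[of "Pos (E u v u' v')"] by simp
        next
          case (E_collision u u' v v' w)
          then have v: "v = s u" "v' = s u'" using neg[of "Neg (E u v u' v')"] by simp_all
          then have "w = h u" "w = h u'"
            using neg[of "Neg (Q u v w)"] neg[of "Neg (Q u' v' w)"] E_collision by simp_all
          moreover have "u \<in> ?D" "u' \<in> ?D"
            using E_collision v by (simp_all add: matched_def mentioned_def)
          ultimately show False using less.prems(2) E_collision(2) by (metis inj_onD less_irrefl)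
        qed
      next
        case (Weakening i)
        then have i: "i < t" "clause_at \<pi> i \<subseteq> ?C" using step by (auto simp: valid_step_def)
        note sub = matched_mono[OF i(2), of k s]
        have "\<not> falsifies (assignment k s b h) (clause_at \<pi> i)"
          using less.IH[OF i(1)] less.prems i(1) inj_on_subset[OF less.prems(2) sub] image_mono[OF sub, of h]
          by (meson less_trans subset_trans)
        then show False using fals i(2) by (auto simp: falsifies_def)
      next
        case (Resolution i j)
        then obtain A B x where ij: "i < t" "j < t" "clause_at \<pi> i = insert (Pos x) A"
          "clause_at \<pi> j = insert (Neg x) B" "?C = A \<union> B"
          using step by (auto simp: valid_step_def)
        \<comment> \<open>The resolved variable has at most one element and so concerns the hole of
          at most one pigeon; if it has none, any \<open>u\<close> will do.\<close>
        obtain u where u: "\<And>v. (v, s v) \<in> element x \<Longrightarrow> v = u"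
          by (cases x) auto
        obtain h' where h': "\<And>v. v \<in> ?D \<Longrightarrow> h' v = h v" "inj_on h' (insert u ?D)"
          "h' ` insert u ?D \<subseteq> {..<k - 1}"
          using extend_injection[OF finite_matched small[OF less.prems(1) fals] less.prems(2,3), of u]
          by blast
        have sub: "matched k s (clause_at \<pi> i) \<subseteq> insert u ?D" "matched k s (clause_at \<pi> j) \<subseteq> insert u ?D"
          using u unfolding ij by (auto simp: matched_def mentioned_def)
        \<comment> \<open>The extension changes nothing on the pigeons matched by the conclusion,
          which stays falsified; the value of \<open>x\<close> then decides which premise is
          falsified too.\<close>
        have "falsifies (assignment k s b h') ?C"
          using falsifies_cong[of k s ?C h h' b] h'(1) fals by simp
        then have "falsifies (assignment k s b h') (clause_at \<pi> i) \<or>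
            falsifies (assignment k s b h') (clause_at \<pi> j)"
          unfolding ij by (cases "assignment k s b h' x") (auto simp: falsifies_def)
        moreover have "\<not> falsifies (assignment k s b h') (clause_at \<pi> i)"
          using less.IH[OF ij(1)] less.prems(1) ij(1) inj_on_subset[OF h'(2) sub(1)]
            image_mono[OF sub(1), of h'] h'(3) by (meson less_trans subset_trans)
        moreover have "\<not> falsifies (assignment k s b h') (clause_at \<pi> j)"
          using less.IH[OF ij(2)] less.prems(1) ij(2) inj_on_subset[OF h'(2) sub(2)]
            image_mono[OF sub(2), of h'] h'(3) by (meson less_trans subset_trans)
        ultimately show False by blast
      qed
    qed
  qed
  have "\<pi> \<noteq> []" "clause_at \<pi> (length \<pi> - 1) = {}"
    using ref by (auto simp: refutation_def derivation_def last_conv_nth)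
  then show False using no[of "length \<pi> - 1"]
    by (simp add: falsifies_def matched_def mentioned_def)
qed

section \<open>Counting the choices and bits under which a clause survives\<close>

lemma prod_le_of_sum_le:
  fixes f :: "'a \<Rightarrow> real"
  assumes "finite A" "\<And>a. a \<in> A \<Longrightarrow> 0 \<le> f a" "0 < x" "sum f A \<le> (real (card A) + c) * x"
  shows "prod f A \<le> exp c * x ^ card A"
proof -
  \<comment> \<open>This is \<open>1 + t \<le> exp t\<close> at \<open>t = f a / x - 1\<close>. In
    the product the exponents add up to \<open>sum f A / x - card A\<close>, which is at most
    \<open>c\<close>.\<close>
  have le: "f a \<le> x * exp (f a / x - 1)" for a
    using exp_ge_add_one_self[of "f a / x - 1"] assms(3) by (simp add: field_simps)
  have "prod f A \<le> (\<Prod>a\<in>A. x * exp (f a / x - 1))"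
    by (intro prod_mono) (use assms(2) le in auto)
  also have "\<dots> = x ^ card A * exp (\<Sum>a\<in>A. f a / x - 1)"
    by (simp add: prod.distrib exp_sum assms(1))
  also have "(\<Sum>a\<in>A. f a / x - 1) = sum f A / x - card A"
    by (simp add: sum_subtractf sum_divide_distrib)
  also have "\<dots> \<le> c"
    using assms(3,4) by (simp add: field_simps)
  finally show ?thesis using assms(3) by (simp add: mult.commute)
qed

text \<open>All pigeons but at most one, \<open>u0\<close>, must hit the mentioned part
  \<open>V u\<close> of their block. The exceptional pigeon is free, which gives the factor
  \<open>N\<close>, and the sum over \<open>u0\<close> gives the factor \<open>k\<close>.\<close>

lemma card_choices_le:
  fixes m :: real
  assumes k: "1 \<le> k" and m: "0 < m"
    and le: "card (mentioned C \<inter> {..<k} \<times> {..<N}) \<le> m"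
  shows "card {s \<in> {..<k} \<rightarrow>\<^sub>E {..<N}. k - 1 \<le> card (matched k s C)}
     \<le> exp 1 * real k * real N * (m / k) ^ (k - 1)"
proof -
  define V where "V u = {v. v < N \<and> (u, v) \<in> mentioned C}" for u
  have finV: "finite (V u)" for u by (simp add: V_def)
  define P where "P u0 = (\<Pi>\<^sub>E u\<in>{..<k}. if u = u0 then {..<N} else V u)" for u0
  have "{s \<in> {..<k} \<rightarrow>\<^sub>E {..<N}. k - 1 \<le> card (matched k s C)} \<subseteq> (\<Union>u0<k. P u0)"
  proof clarify
    fix s assume s: "s \<in> {..<k} \<rightarrow>\<^sub>E {..<N}" and c: "k - 1 \<le> card (matched k s C)"
    have "card ({..<k} - matched k s C) \<le> 1"
      using c by (subst card_Diff_subset) (auto simp: matched_subset)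
    then have eq: "\<forall>a\<in>{..<k} - matched k s C. \<forall>b\<in>{..<k} - matched k s C. a = b"
      by (simp add: card_le_Suc0_iff_eq)
    obtain u0 where u0: "u0 < k" "{..<k} - matched k s C \<subseteq> {u0}"
    proof (cases "{..<k} - matched k s C = {}")
      \<comment> \<open>If all pigeons are matched, any of them can be taken as the exceptional
        one.\<close>
      case True
      show ?thesis by (rule that[of 0]) (use True k in auto)
    next
      case False
      then obtain a where "a \<in> {..<k} - matched k s C" by blast
      then show ?thesis using that[of a] eq by blast
    qed
    have "s \<in> P u0" unfolding P_def
      using s u0 by (auto simp: PiE_iff V_def matched_def)
    then show "s \<in> (\<Union>u0<k. P u0)" using u0 by blast
  qed
  then have "card {s \<in> {..<k} \<rightarrow>\<^sub>E {..<N}. k - 1 \<le> card (matched k s C)} \<le> card (\<Union>u0<k. P u0)"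
    by (rule card_mono[rotated]) (auto simp: P_def finV intro!: finite_PiE)
  also have "\<dots> \<le> (\<Sum>u0<k. card (P u0))" by (rule card_UN_le) simp
  finally have nat_le: "card {s \<in> {..<k} \<rightarrow>\<^sub>E {..<N}. k - 1 \<le> card (matched k s C)}
      \<le> (\<Sum>u0<k. card (P u0))" .
  have "real (card {s \<in> {..<k} \<rightarrow>\<^sub>E {..<N}. k - 1 \<le> card (matched k s C)})
      \<le> (\<Sum>u0<k. real (card (P u0)))"
    using of_nat_mono[OF nat_le, where 'a = real] by (simp only: of_nat_sum)
  also have "\<dots> \<le> (\<Sum>u0<k. real N * (exp 1 * (m / k) ^ (k - 1)))"
  proof (rule sum_mono)
    fix u0 assume u0: "u0 \<in> {..<k}"
    have "card (P u0) = (\<Prod>u<k. card (if u = u0 then {..<N} else V u))"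
      by (simp add: P_def card_PiE)
    also have "\<dots> = N * (\<Prod>u\<in>{..<k} - {u0}. card (if u = u0 then {..<N} else V u))"
      using u0 by (subst prod.remove[of _ u0]) auto
    also have "(\<Prod>u\<in>{..<k} - {u0}. card (if u = u0 then {..<N} else V u)) = (\<Prod>u\<in>{..<k} - {u0}. card (V u))"
      by (rule prod.cong) auto
    finally have "real (card (P u0)) = N * (\<Prod>u\<in>{..<k} - {u0}. real (card (V u)))" by simp
    also have "(\<Prod>u\<in>{..<k} - {u0}. real (card (V u))) \<le> exp 1 * (m / k) ^ card ({..<k} - {u0})"
    proof (rule prod_le_of_sum_le)
      have "(\<Sum>u\<in>{..<k} - {u0}. card (V u)) \<le> (\<Sum>u<k. card (V u))"
        by (rule sum_mono2) auto
      also have "\<dots> = card (SIGMA u:{..<k}. V u)" by (simp add: finV)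
      also have "(SIGMA u:{..<k}. V u) = mentioned C \<inter> {..<k} \<times> {..<N}"
        by (auto simp: V_def)
      finally have "real (\<Sum>u\<in>{..<k} - {u0}. card (V u)) \<le> m" using le by linarith
      \<comment> \<open>Only \<open>k - 1\<close> blocks share the total \<open>m\<close>, which is
        \<open>k\<close> times \<open>m / k\<close>; the missing summand is the 1 that costs the
        factor \<open>exp 1\<close>.\<close>
      moreover have "(real (card ({..<k} - {u0})) + 1) * (m / k) = m"
        using u0 k by (simp add: of_nat_diff)
      ultimately show "(\<Sum>u\<in>{..<k} - {u0}. real (card (V u))) \<le> (real (card ({..<k} - {u0})) + 1) * (m / k)"
        by simp
    qed (use m k in auto)
    also have "card ({..<k} - {u0}) = k - 1" using u0 by simp
    finally show "real (card (P u0)) \<le> real N * (exp 1 * (m / k) ^ (k - 1))"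
      by (simp add: mult_left_mono)
  qed
  also have "\<dots> = exp 1 * real k * real N * (m / k) ^ (k - 1)" by simp
  finally show ?thesis .
qed

text \<open>For fixed \<open>s\<close>, a falsified clause prescribes the bit of each mentioned
  element that is not chosen, whatever the holes are. At most \<open>k\<close> mentioned elements
  are chosen, which costs the factor \<open>2 ^ k\<close>.\<close>

lemma card_bits_le:
  "card {b \<in> Pow ({..<k} \<times> {..<N}). \<exists>h. falsifies (assignment k s b h) C}
     * 2 ^ card (mentioned C \<inter> {..<k} \<times> {..<N}) \<le> 2 ^ (k * N + k)"
proof -
  define M where "M = {..<k} \<times> {..<N}"
  define I where "I = mentioned C \<inter> M"
  define J where "J = I - (\<lambda>u. (u, s u)) ` {..<k}"
  \<comment> \<open>These are the elements whose prescribed bit is true, since a falsified negative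
    literal has a true variable.\<close>
  define P where "P = {e. \<exists>x. Neg x \<in> C \<and> e \<in> element x}"
  have fin: "finite M" "finite I" "finite J" "J \<subseteq> M" by (auto simp: M_def I_def J_def)
  have "card I - card ((\<lambda>u. (u, s u)) ` {..<k}) \<le> card J"
    unfolding J_def by (rule diff_card_le_card_Diff) simp
  moreover have "card ((\<lambda>u. (u, s u)) ` {..<k}) \<le> k"
    using card_image_le[of "{..<k}"] by simp
  ultimately have cJ: "card I \<le> card J + k" by linarith
  have JM: "card J \<le> card M" using fin by (simp add: card_mono)
  have bits: "b \<inter> J = P \<inter> J" if fals: "falsifies (assignment k s b h) C" for b h
  proof -
    have *: "assignment k s b h x \<longleftrightarrow> e \<in> b" if "e \<in> J" "e \<in> element x" for e x
      using that by (cases x) (auto simp: J_def I_def M_def)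
    have "e \<in> b \<longleftrightarrow> e \<in> P" if e: "e \<in> J" for e
    proof
      assume "e \<in> P"
      then obtain x where "Neg x \<in> C" "e \<in> element x" by (auto simp: P_def)
      then show "e \<in> b" using fals *[OF e, of x] by (force simp: falsifies_def)
    next
      assume "e \<in> b"
      obtain l where l: "l \<in> C" "e \<in> element (var l)" using e by (auto simp: J_def I_def mentioned_def)
      have "\<not> holds (assignment k s b h) l" using fals l by (simp add: falsifies_def)
      then show "e \<in> P" using *[OF e l(2)] \<open>e \<in> b\<close> l by (cases l) (auto simp: P_def)
    qed
    then show ?thesis by blast
  qed
  have "card {b \<in> Pow M. \<exists>h. falsifies (assignment k s b h) C} \<le> card (Pow (M - J))"
  proof (rule card_inj_on_le[of "\<lambda>b. b - J"])
    show "inj_on (\<lambda>b. b - J) {b \<in> Pow M. \<exists>h. falsifies (assignment k s b h) C}"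
    proof (rule inj_onI, clarify)
      fix b h b' h' assume "falsifies (assignment k s b h) C" "falsifies (assignment k s b' h') C"
        "b - J = b' - J"
      then show "b = b'" using bits[of b h] bits[of b' h'] by blast
    qed
  qed (use fin in auto)
  also have "\<dots> = 2 ^ (card M - card J)" using fin by (simp add: card_Pow card_Diff_subset)
  finally have "card {b \<in> Pow M. \<exists>h. falsifies (assignment k s b h) C} * 2 ^ card I
      \<le> 2 ^ (card M - card J) * 2 ^ (card J + k)"
    using cJ by (intro mult_mono) (auto intro: power_increasing)
  also have "\<dots> = 2 ^ (card M + k)" using JM by (simp flip: power_add)
  finally show ?thesis by (simp add: M_def I_def)
qed

text \<open>The event of the union bound: the outcomes for which \<open>C\<close> can serve as the
  clause found in \<open>exists_matched_clause\<close>. Extensional choice functions make the sample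
  space finite, with \<open>N ^ k * 2 ^ (k * N)\<close> points.\<close>

definition critical :: "nat \<Rightarrow> nat \<Rightarrow> rvar clause \<Rightarrow> ((nat \<Rightarrow> nat) \<times> (nat \<times> nat) set) set" where
  "critical k N C = {(s, b). s \<in> {..<k} \<rightarrow>\<^sub>E {..<N} \<and> b \<in> Pow ({..<k} \<times> {..<N}) \<and>
     (\<exists>h. falsifies (assignment k s b h) C) \<and> k - 1 \<le> card (matched k s C)}"

text \<open>If \<open>C\<close> mentions at most \<open>m\<close> elements, only the choices are
  restricted and all bits are allowed; otherwise the bits are counted separately for each
  choice.\<close>

lemma card_critical_le:
  fixes n :: nat
  assumes k: "1 \<le> k" and n: "2 \<le> n" "n \<le> k * N"
  shows "card (critical k N C)
    \<le> (4 * real k * log 2 (real n)) ^ k / real n ^ (k - 1) * (real N ^ k * 2 ^ (k * N))"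
proof -
  define m where "m = 4 * real k * log 2 (real n)"
  have log: "1 \<le> log 2 (real n)" using n by (subst le_log_iff) auto
  have m: "4 * real k \<le> m" using mult_left_mono[OF log, of "4 * real k"] by (simp add: m_def)
  define S where "S = {..<k} \<rightarrow>\<^sub>E {..<N}"
  define M where "M = {..<k} \<times> {..<N}"
  have fin: "finite S" "finite M" by (auto simp: S_def M_def intro: finite_PiE)
  have cards: "card S = N ^ k" "card M = k * N" by (auto simp: S_def M_def card_PiE)
  have "real (card (critical k N C)) \<le> m ^ k / real n ^ (k - 1) * (real N ^ k * 2 ^ (k * N))"
  proof (cases "real (card (mentioned C \<inter> M)) \<le> m")
    case True
    have "critical k N C \<subseteq> {s \<in> S. k - 1 \<le> card (matched k s C)} \<times> Pow M"
      by (auto simp: critical_def S_def M_def)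
    then have "card (critical k N C) \<le> card {s \<in> S. k - 1 \<le> card (matched k s C)} * 2 ^ (k * N)"
      using card_mono[of "{s \<in> S. k - 1 \<le> card (matched k s C)} \<times> Pow M"] fin cards
      by (simp add: card_cartesian_product card_Pow)
    from of_nat_mono[OF this, where 'a = real] have "real (card (critical k N C))
        \<le> real (card {s \<in> S. k - 1 \<le> card (matched k s C)}) * 2 ^ (k * N)"
      by (simp only: of_nat_mult of_nat_power of_nat_numeral)
    also have "\<dots> \<le> (exp 1 * real k * real N * (m / k) ^ (k - 1)) * 2 ^ (k * N)"
      using card_choices_le[of k m C N] True k m by (intro mult_right_mono) (auto simp: S_def M_def)
    also have "\<dots> \<le> m ^ k / real n ^ (k - 1) * real N ^ k * 2 ^ (k * N)"
    proof (rule mult_right_mono)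
      \<comment> \<open>The factor \<open>exp 1 * k\<close> is absorbed by
        \<open>m \<ge> 4 * k\<close>, and \<open>n \<le> k * N\<close> turns each
        \<open>(m / k) * n\<close> into at most \<open>m * N\<close>.\<close>
      have "exp 1 * real k * real N * (m / k) ^ (k - 1) * real n ^ (k - 1)
          \<le> m * real N * (m / k) ^ (k - 1) * real (k * N) ^ (k - 1)"
      proof (intro mult_mono power_mono)
        show "exp 1 * real k \<le> m" using mult_right_mono[OF exp_le, of "real k"] m by linarith
      qed (use m n of_nat_mono[OF n(2), where 'a = real] in auto)
      also have "\<dots> = (m * real N) * (m / k * real (k * N)) ^ (k - 1)"
        by (simp only: power_mult_distrib[of "m / k"] mult.assoc)
      also have "m / k * real (k * N) = m * real N" using k by simp
      also have "(m * real N) * (m * real N) ^ (k - 1) = m ^ k * real N ^ k"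
        using k by (simp flip: power_Suc power_mult_distrib)
      finally show "exp 1 * real k * real N * (m / k) ^ (k - 1) \<le> m ^ k / real n ^ (k - 1) * real N ^ k"
        using n by (simp add: field_simps)
    qed simp
    finally show ?thesis by (simp add: mult.assoc)
  next
    case False
    define B where "B s = {b \<in> Pow M. \<exists>h. falsifies (assignment k s b h) C}" for s
    have finB: "finite (B s)" for s using fin by (simp add: B_def)
    have "critical k N C \<subseteq> (SIGMA s:S. B s)"
      by (auto simp: critical_def S_def M_def B_def)
    then have "card (critical k N C) \<le> (\<Sum>s\<in>S. card (B s))"
      using card_mono[of "SIGMA s:S. B s"] fin finB by simp
    from of_nat_mono[OF this, where 'a = real]
    have "real (card (critical k N C)) \<le> (\<Sum>s\<in>S. real (card (B s)))"
      by (simp only: of_nat_sum)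
    also have "\<dots> \<le> (\<Sum>s\<in>S. m ^ k / real n ^ (k - 1) * 2 ^ (k * N))"
    proof (rule sum_mono)
      fix s
      \<comment> \<open>The threshold \<open>m\<close> is chosen so that
        \<open>2 powr m = n ^ (4 * k)\<close>.\<close>
      have pow: "real n ^ (4 * k) \<le> 2 ^ card (mentioned C \<inter> M)"
      proof -
        have "real n ^ (4 * k) = (2 powr log 2 (real n)) powr (4 * real k)"
          using n by (simp flip: powr_realpow)
        also have "\<dots> = 2 powr m" by (simp add: powr_powr m_def mult_ac)
        also have "\<dots> \<le> 2 powr real (card (mentioned C \<inter> M))" using False by simp
        finally show ?thesis by (simp add: powr_realpow)
      qed
      have "real (card (B s)) * real n ^ (4 * k) \<le> real (card (B s)) * 2 ^ card (mentioned C \<inter> M)"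
        using pow by (rule mult_left_mono) simp
      also have "\<dots> \<le> 2 ^ (k * N + k)"
        using of_nat_mono[OF card_bits_le[of k N s C], where 'a = real]
        by (simp only: B_def M_def of_nat_mult of_nat_power of_nat_numeral)
      also have "\<dots> = 2 ^ (k * N) * 2 ^ k" by (simp add: power_add)
      also have "\<dots> \<le> 2 ^ (k * N) * real n ^ k"
        using n by (intro mult_left_mono power_mono) auto
      finally have 1: "real (card (B s)) * real n ^ (4 * k) \<le> 2 ^ (k * N) * real n ^ k" .
      \<comment> \<open>Of the \<open>4 * k\<close> factors \<open>n\<close>, \<open>k\<close> pay
        for \<open>2 ^ k\<close> and \<open>k - 1\<close> give the claimed denominator.\<close>
      have "real (card (B s)) * real n ^ (k - 1) * real n ^ k
          \<le> real (card (B s)) * real n ^ (4 * k)"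
        unfolding mult.assoc power_add[symmetric]
        using n by (intro mult_left_mono power_increasing) auto
      also note 1
      finally have "real (card (B s)) * real n ^ (k - 1) \<le> 2 ^ (k * N)" using n by simp
      also have "\<dots> \<le> m ^ k * 2 ^ (k * N)"
        using one_le_power[of m k] m k by simp
      finally show "real (card (B s)) \<le> m ^ k / real n ^ (k - 1) * 2 ^ (k * N)"
        using n by (simp add: field_simps)
    qed
    also have "\<dots> = m ^ k / real n ^ (k - 1) * (real N ^ k * 2 ^ (k * N))"
      by (simp add: cards)
    finally show ?thesis .
  qed
  then show ?thesis by (simp add: m_def)
qed

text \<open>Every outcome is critical for some line, and a line accounts for at most a fraction
  \<open>\<beta>\<close> of the outcomes, so there are at least \<open>1 / \<beta>\<close>
  lines.\<close>

lemma rphp_size_lower_bound: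
  fixes n :: nat
  assumes ref: "refutation (rphp k N) \<pi>" and k: "1 \<le> k" and n: "2 \<le> n" "n \<le> k * N"
  shows "real n ^ (k - 1) / (4 * real k * log 2 (real n)) ^ k \<le> real (size_of \<pi>)"
proof -
  define \<beta> where "\<beta> = (4 * real k * log 2 (real n)) ^ k / real n ^ (k - 1)"
  define T where "T = real N ^ k * 2 ^ (k * N)"
  define \<Omega> where "\<Omega> = ({..<k} \<rightarrow>\<^sub>E {..<N}) \<times> Pow ({..<k} \<times> {..<N})"
  have N: "0 < N" using n by (cases N) auto
  have T: "0 < T" using N by (simp add: T_def)
  have \<beta>: "0 < \<beta>" using n k by (simp add: \<beta>_def)
  have "T = card \<Omega>"
    by (simp add: T_def \<Omega>_def card_cartesian_product card_PiE card_Pow)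
  also have "card \<Omega> \<le> card (\<Union>t<length \<pi>. critical k N (clause_at \<pi> t))"
  proof (rule card_mono)
    have "critical k N C \<subseteq> \<Omega>" for C by (auto simp: critical_def \<Omega>_def)
    moreover have "finite \<Omega>" by (auto simp: \<Omega>_def intro!: finite_PiE)
    ultimately show "finite (\<Union>t<length \<pi>. critical k N (clause_at \<pi> t))"
      by (meson finite_UN_I finite_lessThan finite_subset)
    show "\<Omega> \<subseteq> (\<Union>t<length \<pi>. critical k N (clause_at \<pi> t))"
    proof clarify
      fix s b assume sb: "(s, b) \<in> \<Omega>"
      then have "\<And>u. u < k \<Longrightarrow> s u < N" by (auto simp: \<Omega>_def PiE_iff)
      from exists_matched_clause[where s = s and b = b, OF ref this]
      show "(s, b) \<in> (\<Union>t<length \<pi>. critical k N (clause_at \<pi> t))"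
        using sb by (fastforce simp: critical_def \<Omega>_def)
    qed
  qed
  also have "\<dots> \<le> (\<Sum>t<length \<pi>. card (critical k N (clause_at \<pi> t)))"
    by (rule card_UN_le) simp
  finally have "T \<le> (\<Sum>t<length \<pi>. real (card (critical k N (clause_at \<pi> t))))"
    by simp
  also have "\<dots> \<le> (\<Sum>t<length \<pi>. \<beta> * T)"
    by (intro sum_mono) (use card_critical_le[OF k n] in \<open>simp add: \<beta>_def T_def\<close>)
  also have "\<dots> = real (size_of \<pi>) * \<beta> * T" by (simp add: size_of_def)
  finally have "1 \<le> real (size_of \<pi>) * \<beta>" using T by simp
  then have "1 / \<beta> \<le> real (size_of \<pi>)" using \<beta> by (simp add: field_simps)
  then show ?thesis by (simp add: \<beta>_def)
qed

section \<open>Renaming variables\<close>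

definition rename_cnf :: "('v \<Rightarrow> 'w) \<Rightarrow> 'v cnf \<Rightarrow> 'w cnf" where
  "rename_cnf g F = (`) (map_literal g) ` F"

definition rename_derivation :: "('v \<Rightarrow> 'w) \<Rightarrow> 'v derivation \<Rightarrow> 'w derivation" where
  "rename_derivation g \<pi> = map (apfst ((`) (map_literal g))) \<pi>"

lemma length_rename_derivation [simp]: "length (rename_derivation g \<pi>) = length \<pi>"
  by (simp add: rename_derivation_def)

lemma nth_rename_derivation:
  "t < length \<pi> \<Longrightarrow>
     rename_derivation g \<pi> ! t = (map_literal g ` clause_at \<pi> t, snd (\<pi> ! t))"
  by (simp add: rename_derivation_def apfst_def map_prod_def split_beta)

lemma dag_edge_rename [simp]: "dag_edge (rename_derivation g \<pi>) i j \<longleftrightarrow> dag_edge \<pi> i j"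
  by (auto simp: dag_edge_def nth_rename_derivation)

text \<open>The renaming may identify variables: a resolution step stays valid because its side
  clauses may contain the resolved literals.\<close>

lemma valid_step_rename:
  assumes "valid_step F \<pi> t" "t < length \<pi>"
  shows "valid_step (rename_cnf g F) (rename_derivation g \<pi>) t"
proof (cases "snd (\<pi> ! t)")
  case Axiom
  then show ?thesis using assms by (auto simp: valid_step_def nth_rename_derivation rename_cnf_def)
next
  case (Resolution i j)
  then obtain A B x where ij: "i < t" "j < t" "clause_at \<pi> i = insert (Pos x) A"
    "clause_at \<pi> j = insert (Neg x) B" "clause_at \<pi> t = A \<union> B"
    using assms by (auto simp: valid_step_def)
  have "\<exists>A' B' y. map_literal g ` insert (Pos x) A = insert (Pos y) A' \<and>
      map_literal g ` insert (Neg x) B = insert (Neg y) B' \<and> map_literal g ` (A \<union> B) = A' \<union> B'"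
    by (intro exI[of _ "map_literal g ` A"] exI[of _ "map_literal g ` B"] exI[of _ "g x"]) auto
  then show ?thesis using assms(2) Resolution ij
    by (simp add: valid_step_def nth_rename_derivation)
next
  case (Weakening i)
  then show ?thesis using assms by (auto simp: valid_step_def nth_rename_derivation)
qed

lemma derivation_rename:
  assumes "derivation F \<pi> C"
  shows "derivation (rename_cnf g F) (rename_derivation g \<pi>) (map_literal g ` C)"
proof -
  have "fst (last (rename_derivation g \<pi>)) = map_literal g ` fst (last \<pi>)"
    using assms by (simp add: derivation_def rename_derivation_def last_map)
  then show ?thesis using assms valid_step_rename[of F \<pi> _ g]
    by (auto simp: derivation_def nth_rename_derivation) (simp add: rename_derivation_def)
qed

lemma tree_derives_rename:
  assumes "tree_derives F w C s sp"
  shows "tree_derives (rename_cnf g F) w (map_literal g ` C) s sp"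
proof -
  obtain \<pi> where \<pi>: "derivation F \<pi> C" "tree_like \<pi>" "length \<pi> \<le> s"
    and wd: "\<And>t. t < length \<pi> \<Longrightarrow> card (clause_at \<pi> t) \<le> w \<and> space_at \<pi> t \<le> sp"
    using assms unfolding tree_derives_def by blast
  show ?thesis unfolding tree_derives_def
  proof (intro exI[of _ "rename_derivation g \<pi>"] conjI allI impI derivation_rename \<pi>)
    show "tree_like (rename_derivation g \<pi>)" using \<pi>(2) by (simp add: tree_like_def)
  next
    fix t assume t: "t < length (rename_derivation g \<pi>)"
    then have "finite (clause_at \<pi> t)" using \<pi>(1) by (simp add: derivation_def)
    then show "card (clause_at (rename_derivation g \<pi>) t) \<le> w"
      using card_image_le[of "clause_at \<pi> t" "map_literal g"] wd[of t] t
      by (simp add: nth_rename_derivation)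
    show "space_at (rename_derivation g \<pi>) t \<le> sp" using wd[of t] t by (simp add: space_at_def)
  qed (use \<pi> in simp)
qed

lemma refutation_rename: "refutation F \<pi> \<Longrightarrow> refutation (rename_cnf g F) (rename_derivation g \<pi>)"
  using derivation_rename[of F \<pi> "{}" g] by (simp add: refutation_def)

lemma rename_cnf_inverse:
  assumes "\<And>x. h (g x) = x"
  shows "rename_cnf h (rename_cnf g F) = F"
proof -
  have "map_literal h (map_literal g l) = l" for l using assms by (cases l) auto
  then show ?thesis by (simp add: rename_cnf_def image_image)
qed

lemma is_3cnf_rename: "is_3cnf F \<Longrightarrow> is_3cnf (rename_cnf g F)"
  unfolding is_3cnf_def rename_cnf_def by (auto intro: le_trans[OF card_image_le])

lemma vars_rename: "vars (rename_cnf g F) = g ` vars F"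
proof -
  have "var (map_literal g l) = g (var l)" for l by (cases l) auto
  then show ?thesis by (auto simp: vars_def rename_cnf_def image_iff) metis+
qed

lemma finite_vars: "is_3cnf F \<Longrightarrow> finite (vars F)"
  by (auto simp: is_3cnf_def vars_def)

theorem theorem3p1:
  fixes k :: "nat \<Rightarrow> nat"
  assumes k_pos: "\<forall>\<^sub>F n in sequentially. 1 \<le> k n"
    and k_le: "\<And>n. 2 \<le> n \<Longrightarrow> real (k n) \<le> real n / (4 * log 2 (real n))"
  shows "\<exists>F :: nat \<Rightarrow> nat cnf.
    (\<forall>n\<ge>1. is_3cnf (F n)) \<and>
    (\<lambda>n. real (card (vars (F n)))) \<in> O(\<lambda>n. real n ^ 2) \<and>
    (\<lambda>n. real (card (F n))) \<in> O(\<lambda>n. real (k n) * real n ^ 2) \<and>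
    (\<exists>\<pi> :: nat \<Rightarrow> nat derivation.
      (\<forall>n\<ge>1. refutation (F n) (\<pi> n) \<and> tree_like (\<pi> n) \<and>
        width_of (\<pi> n) \<le> 2 * k n + 1 \<and> space_of (\<pi> n) \<le> 2 * k n + 3) \<and>
      (\<lambda>n. real (size_of (\<pi> n))) \<in> O(\<lambda>n. real (k n) ^ k n * real n ^ k n)) \<and>
    (\<exists>c>0. \<forall>\<^sub>F n in sequentially. \<forall>\<pi> :: nat derivation. refutation (F n) \<pi> \<longrightarrow>
      c * (real n ^ (k n - 1) / (4 * real (k n) * log 2 (real n)) ^ k n) \<le> real (size_of \<pi>))"
proof -
  \<comment> \<open>This gives \<open>n \<le> k n * N n \<le> n + k n\<close>: the lower bound needs
    at least \<open>n\<close> elements in total, the upper bounds at most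
    \<open>2 * n\<close>.\<close>
  define N where "N n = n div k n + 1" for n
  define G where "G n = rphp (k n) (N n)" for n
  \<comment> \<open>Without pigeons \<open>rphp\<close> has no clauses and would be satisfiable, so
    \<open>{{}}\<close> takes its place and a refutation exists for every \<open>n\<close>.\<close>
  define F :: "nat \<Rightarrow> nat cnf" where
    "F n = (if k n = 0 then {{}} else rename_cnf to_nat (G n))" for n
  have ev: "\<forall>\<^sub>F n in sequentially. 1 \<le> k n \<and> 2 \<le> n"
    by (intro eventually_conj k_pos eventually_ge_at_top)
  have k_le_n: "k n \<le> n" if "2 \<le> n" for n
  proof -
    have "1 \<le> log 2 (real n)" using that by (subst le_log_iff) auto
    then have "1 \<le> 4 * log 2 (real n)" by linarith
    then have "real n / (4 * log 2 (real n)) \<le> real n / 1" by (intro divide_left_mono) auto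
    then show ?thesis using k_le[OF that] by simp
  qed
  have kN: "k n \<le> k n * N n" "n \<le> k n * N n" "k n * N n \<le> n + k n" if "1 \<le> k n" for n
  proof -
    have "k n * (n div k n) + n mod k n = n" by simp
    moreover have "n mod k n < k n" using that by simp
    ultimately show "k n \<le> k n * N n" "n \<le> k n * N n" "k n * N n \<le> n + k n"
      by (simp_all only: N_def distrib_left mult_1_right)
  qed
  have kN2: "k n * N n \<le> 2 * n" if "1 \<le> k n" "2 \<le> n" for n
    using kN(3)[OF that(1)] k_le_n[OF that(2)] by simp
  have sq: "(k n * N n)\<^sup>2 \<le> 4 * n\<^sup>2" if "1 \<le> k n" "2 \<le> n" for n
    using power_mono[OF kN2[OF that], of 2] by simp
  have three: "is_3cnf (F n)" for n
    by (cases "k n = 0") (auto simp: F_def G_def is_3cnf_def[of "{{}}"] intro: is_3cnf_rename is_3cnf_rphp)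
  have vars: "(\<lambda>n. real (card (vars (F n)))) \<in> O(\<lambda>n. real n ^ 2)"
  proof (rule bigoI[of _ 32], use ev in eventually_elim)
    case (elim n)
    have "card (vars (F n)) \<le> card (vars (G n))"
      using elim finite_vars[OF is_3cnf_rphp]
      by (auto simp: F_def G_def vars_rename intro: card_image_le)
    also have "\<dots> \<le> 8 * (k n * N n)\<^sup>2" unfolding G_def using card_vars_rphp_le kN elim by blast
    also have "\<dots> \<le> 32 * n\<^sup>2" using sq[of n] elim by simp
    finally have "real (card (vars (F n))) \<le> real (32 * n\<^sup>2)" by (rule of_nat_mono)
    then show ?case by simp
  qed
  have clauses: "(\<lambda>n. real (card (F n))) \<in> O(\<lambda>n. real (k n) * real n ^ 2)"
  proof (rule bigoI[of _ 32], use ev in eventually_elim)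
    case (elim n)
    have "card (F n) \<le> card (G n)"
      using elim finite_rphp by (auto simp: F_def G_def rename_cnf_def intro: card_image_le)
    also have "\<dots> \<le> 8 * k n * (k n * N n)\<^sup>2" unfolding G_def using card_rphp_le kN elim by blast
    also have "\<dots> \<le> 8 * k n * (4 * n\<^sup>2)" by (intro mult_le_mono order_refl sq) (use elim in auto)
    finally have "real (card (F n)) \<le> real (8 * k n * (4 * n\<^sup>2))" by (rule of_nat_mono)
    then show ?case by simp
  qed
  define s where "s n = (if k n = 0 then 1 else 4 * (32 * k n * N n) ^ k n)" for n
  have "tree_derives (F n) (2 * k n + 1) {} (s n) (2 * k n + 3)" for n
  proof (cases "k n = 0")
    case True
    have "tree_derives {{}} 1 ({} :: nat clause) 1 1" by (rule tree_derives_axiom) auto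
    then show ?thesis using True by (auto simp: F_def s_def elim: tree_derives_mono)
  next
    case False
    then have "tree_derives (G n) (2 * k n + 1) {} (s n) (2 * k n + 3)"
      using rphp_tree_refutation[of "k n" "N n"] by (simp add: G_def s_def N_def)
    from tree_derives_rename[OF this, of to_nat] show ?thesis using False by (simp add: F_def)
  qed
  then obtain \<pi> where \<pi>: "\<And>n. derivation (F n) (\<pi> n) {} \<and> tree_like (\<pi> n) \<and> length (\<pi> n) \<le> s n \<and>
     (\<forall>t<length (\<pi> n). card (clause_at (\<pi> n) t) \<le> 2 * k n + 1 \<and> space_at (\<pi> n) t \<le> 2 * k n + 3)"
    unfolding tree_derives_def by metis
  have "\<exists>\<pi> :: nat \<Rightarrow> nat derivation.
      (\<forall>n\<ge>1. refutation (F n) (\<pi> n) \<and> tree_like (\<pi> n) \<and>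
        width_of (\<pi> n) \<le> 2 * k n + 1 \<and> space_of (\<pi> n) \<le> 2 * k n + 3) \<and>
      (\<lambda>n. real (size_of (\<pi> n))) \<in> O(\<lambda>n. real (k n) ^ k n * real n ^ k n)"
  proof (intro exI[of _ \<pi>] conjI allI impI)
    fix n
    show "refutation (F n) (\<pi> n)" "tree_like (\<pi> n)" using \<pi>[of n] by (auto simp: refutation_def)
    have "{..<length (\<pi> n)} \<noteq> {}" using \<pi>[of n] by (simp add: derivation_def lessThan_empty_iff)
    then show "width_of (\<pi> n) \<le> 2 * k n + 1" "space_of (\<pi> n) \<le> 2 * k n + 3"
      unfolding width_of_def space_of_def using \<pi>[of n] by (subst Max_le_iff; simp)+
  next
    show "(\<lambda>n. real (size_of (\<pi> n))) \<in> O(\<lambda>n. real (k n) ^ k n * real n ^ k n)"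
    \<comment> \<open>The search costs \<open>64 ^ k\<close>, from 32 and
      \<open>k * N \<le> 2 * n\<close>. It is at most \<open>64 ^ 64\<close> for
      \<open>k \<le> 64\<close> and at most \<open>k ^ k\<close> beyond.\<close>
    proof (rule bigoI[of _ "4 * 64 ^ 64"], use ev in eventually_elim)
      case (elim n)
      have "length (\<pi> n) \<le> 4 * (32 * (k n * N n)) ^ k n" using \<pi>[of n] elim by (simp add: s_def mult.assoc)
      also have "\<dots> \<le> 4 * (32 * (2 * n)) ^ k n"
        by (intro mult_le_mono power_mono order_refl kN2) (use elim in auto)
      also have "\<dots> = 4 * (64 ^ k n * n ^ k n)" by (simp add: power_mult_distrib)
      also have "\<dots> \<le> 4 * (64 ^ 64 * k n ^ k n * n ^ k n)"
      proof (intro mult_le_mono order_refl)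
        show "64 ^ k n \<le> 64 ^ 64 * k n ^ k n"
        proof (cases "k n \<le> 64")
          case True
          have "64 ^ k n * 1 \<le> 64 ^ 64 * k n ^ k n"
            by (intro mult_le_mono power_increasing True one_le_power) (use elim in auto)
          then show ?thesis by simp
        next
          case False
          have "1 * 64 ^ k n \<le> 64 ^ 64 * k n ^ k n"
            by (intro mult_le_mono power_mono) (use False in auto)
          then show ?thesis by simp
        qed
      qed
      finally have "real (length (\<pi> n)) \<le> real (4 * (64 ^ 64 * k n ^ k n * n ^ k n))" by (rule of_nat_mono)
      then show ?case by (simp add: size_of_def mult.assoc)
    qed
  qed
  moreover have "\<exists>c>0. \<forall>\<^sub>F n in sequentially. \<forall>\<pi> :: nat derivation. refutation (F n) \<pi> \<longrightarrow>
      c * (real n ^ (k n - 1) / (4 * real (k n) * log 2 (real n)) ^ k n) \<le> real (size_of \<pi>)"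
  proof (intro exI[of _ 1] conjI)
    show "\<forall>\<^sub>F n in sequentially. \<forall>\<pi> :: nat derivation. refutation (F n) \<pi> \<longrightarrow>
      1 * (real n ^ (k n - 1) / (4 * real (k n) * log 2 (real n)) ^ k n) \<le> real (size_of \<pi>)"
      using ev
    proof eventually_elim
      case (elim n)
      show ?case
      proof (intro allI impI)
        fix \<pi> :: "nat derivation" assume "refutation (F n) \<pi>"
        \<comment> \<open>The given refutation may use numbers that encode no variable.
          \<open>from_nat\<close> maps them somewhere, which is harmless since renaming need not be
          injective.\<close>
        from refutation_rename[OF this, of "from_nat :: nat \<Rightarrow> rvar"]
        have "refutation (rphp (k n) (N n)) (rename_derivation (from_nat :: nat \<Rightarrow> rvar) \<pi>)"
          using elim by (simp add: F_def G_def rename_cnf_inverse)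
        from rphp_size_lower_bound[OF this, of n] kN(2)[of n] elim
        show "1 * (real n ^ (k n - 1) / (4 * real (k n) * log 2 (real n)) ^ k n) \<le> real (size_of \<pi>)"
          by (simp add: size_of_def)
      qed
    qed
  qed simp
  ultimately show ?thesis using three vars clauses by blast
qed

end
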